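(* Let $M$ be a matroid of rank $k$ on the ground set $E$ of size $n$. Then $$\widehat{\rho}(I(M))= \max_{U \subseteq E,\ \mathrm{rk}_M(U)<k}\left\{ \frac{k-\mathrm{rk}_M(U)}{\widehat{\alpha}(I(M/U))}\right \} = \max_{U \in \mathcal{I}(M),\ |U|<k}\left\{ \frac{k-|U|}{\widehat{\alpha}(I(M/U))} \right \} = \max_{F \in \mathcal{L}(M) \setminus \{E\}}\left\{ \frac{k-\mathrm{rk}_M(F)}{\widehat{\alpha}(I(M/F))} \right \},$$ where $\mathcal{I}(M)$ is the set of independent sets of $M$ and $\mathcal{L}(M)$ is the lattice of flats of $M$.
   Context: Let $\mathbb{K}$ be a field, $S=\mathbb{K}[x_e : e\in E]$ the standard graded polynomial ring, and $x^U=\prod_{i\in U}x_i$ for $U\subseteq E$. For a squarefree monomial ideal $I\subseteq S$ and $s\ge 1$, the $s$-th symbolic power is $I^{(s)}=\bigcap_{P\in \mathrm{Min}(I)}P^s$, where $\mathrm{Min}(I)$ is the set of minimal primes of $I$. For a nonzero homogeneous ideal $I$, $\alpha(I)$ is the smallest degree of a nonzero homogeneous element of $I$; the Waldschmidt constant is $\widehat{\alpha}(I)=\lim_{s\to\infty}\alpha(I^{(s)})/s$. The asymptotic resurgence is $\widehat{\rho}(I)=\sup\{ s/r : s,r \text{ positive integers and } I^{(st)}\not\subseteq I^{rt}\text{ for all } t\gg 0\}$. For a matroid $M$ on $E$ with set of bases $\mathcal{B}(M)$, the facet ideal is $I(M)=\langle x^B : B\in\mathcal{B}(M)\rangle$.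 The rank of $U\subseteq E$ is $\mathrm{rk}_M(U)=\max\{|U\cap B| : B\in \mathcal{B}(M)\}$, and the rank of $M$ is $\mathrm{rk}(M)=\mathrm{rk}_M(E)$. A flat is a subset $F\subseteq E$ that is maximal under inclusion among sets of its rank containing it (equal to its own closure). The contraction $M/U$ is the matroid on $E\setminus U$ of rank $\mathrm{rk}(M)-\mathrm{rk}_M(U)$ whose bases are the sets $B\subseteq E\setminus U$ for which there is a basis $B'$ of the restriction $M|U$ with $B\cup B'\in\mathcal{B}(M)$; $I(M/U)$ may be regarded as an ideal of $S$. Standing assumptions: $1\le k<n$. *)

theory Defs
  imports
    "HOL-Algebra.Ideal_Product"
    "HOL-Library.Poly_Mapping"
    "HOL-Library.Extended_Real"
begin

section \<open>Matroids presented by their bases\<close>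

record 'e matroid_data =
  ground :: "'e set"
  bases :: "'e set set"

locale matroid =
  fixes M :: "'e matroid_data"
  assumes finite_ground: "finite (ground M)"
    and bases_nonempty: "bases M \<noteq> {}"
    and bases_subset: "B \<in> bases M \<Longrightarrow> B \<subseteq> ground M"
    and basis_exchange:
      "\<lbrakk>B\<^sub>1 \<in> bases M; B\<^sub>2 \<in> bases M; x \<in> B\<^sub>1 - B\<^sub>2\<rbrakk>
        \<Longrightarrow> \<exists>y \<in> B\<^sub>2 - B\<^sub>1. insert y (B\<^sub>1 - {x}) \<in> bases M"

definition indep_sets :: "'e matroid_data \<Rightarrow> 'e set set" where
  "indep_sets M = {A. \<exists>B \<in> bases M. A \<subseteq> B}"

definition rk :: "'e matroid_data \<Rightarrow> 'e set \<Rightarrow> nat" where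
  "rk M U = (MAX B \<in> bases M. card (U \<inter> B))"

definition flats :: "'e matroid_data \<Rightarrow> 'e set set" where
  "flats M = {F. F \<subseteq> ground M \<and>
    (\<forall>G. F \<subseteq> G \<and> G \<subseteq> ground M \<and> rk M G = rk M F \<longrightarrow> G = F)}"

definition restriction :: "'e matroid_data \<Rightarrow> 'e set \<Rightarrow> 'e matroid_data" where
  "restriction M U = \<lparr>ground = U,
    bases = {B. B \<subseteq> U \<and> B \<in> indep_sets M \<and>
      (\<forall>A. B \<subseteq> A \<and> A \<subseteq> U \<and> A \<in> indep_sets M \<longrightarrow> A = B)}\<rparr>"

definition contraction :: "'e matroid_data \<Rightarrow> 'e set \<Rightarrow> 'e matroid_data" where
  "contraction M U = \<lparr>ground = ground M - U,
    bases = {B. B \<subseteq> ground M - U \<and> (\<exists>B' \<in> bases (restriction M U). B \<union> B' \<in> bases M)}\<rparr>"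


section \<open>The polynomial ring\<close>

text \<open>
  A polynomial is a finitely supported map from exponent vectors to coefficients. The ring
  \<open>K[x\<^sub>e : e \<in> E]\<close> consists of those in which only variables indexed by \<open>E\<close> occur, so that \<open>E\<close> may
  be any subset of the index type. The first argument only fixes the coefficient field.
\<close>

type_synonym ('e, 'k) mpoly = "('e \<Rightarrow>\<^sub>0 nat) \<Rightarrow>\<^sub>0 'k"

definition mpoly_ring :: "'k::field itself \<Rightarrow> 'e set \<Rightarrow> ('e, 'k) mpoly ring" where
  "mpoly_ring K E = \<lparr>carrier = {p. \<forall>m \<in> Poly_Mapping.keys p. Poly_Mapping.keys m \<subseteq> E},
    mult = (*), one = 1, zero = 0, add = (+)\<rparr>"

definition var :: "'e \<Rightarrow> ('e, 'k::field) mpoly" where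
  "var e = Poly_Mapping.single (Poly_Mapping.single e 1) 1"

definition sqfree_monom :: "'e set \<Rightarrow> ('e, 'k::field) mpoly" where
  "sqfree_monom U = (\<Prod>e\<in>U. var e)"

definition homogeneous :: "nat \<Rightarrow> ('e, 'k::field) mpoly \<Rightarrow> bool" where
  "homogeneous d p \<longleftrightarrow>
    (\<forall>m \<in> Poly_Mapping.keys p. (\<Sum>e \<in> Poly_Mapping.keys m. Poly_Mapping.lookup m e) = d)"


section \<open>Symbolic powers and asymptotic invariants\<close>

abbreviation ideal_power :: "('a, 'b) ring_scheme \<Rightarrow> 'a set \<Rightarrow> nat \<Rightarrow> 'a set" where
  "ideal_power R I s \<equiv> I [^]\<^bsub>ideals_set R\<^esub> s"

definition minimal_primes :: "('a, 'b) ring_scheme \<Rightarrow> 'a set \<Rightarrow> 'a set set" where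
  "minimal_primes R I = {P. primeideal P R \<and> I \<subseteq> P \<and>
    (\<forall>Q. primeideal Q R \<and> I \<subseteq> Q \<and> Q \<subseteq> P \<longrightarrow> Q = P)}"

text \<open>
  Intersecting with the carrier makes the intersection of the empty family the unit ideal; this
  concerns only \<open>I = R\<close>.
\<close>

definition symbolic_power :: "('a, 'b) ring_scheme \<Rightarrow> 'a set \<Rightarrow> nat \<Rightarrow> 'a set" where
  "symbolic_power R I s = carrier R \<inter> (\<Inter>P \<in> minimal_primes R I. ideal_power R P s)"

definition initial_degree :: "('e, 'k::field) mpoly set \<Rightarrow> nat" where
  "initial_degree I = (LEAST d. \<exists>f \<in> I. f \<noteq> 0 \<and> homogeneous d f)"

definition waldschmidt_constant ::
    "('e, 'k::field) mpoly ring \<Rightarrow> ('e, 'k) mpoly set \<Rightarrow> real" where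
  "waldschmidt_constant R I =
    lim (\<lambda>s. real (initial_degree (symbolic_power R I s)) / real s)"

text \<open>
  The supremum is taken in the extended reals, so an equation with a real number also asserts that
  the set is nonempty and bounded.
\<close>

definition asymptotic_resurgence :: "('a, 'b) ring_scheme \<Rightarrow> 'a set \<Rightarrow> ereal" where
  "asymptotic_resurgence R I = Sup {ereal (real s / real r) | s r :: nat.
    0 < s \<and> 0 < r \<and>
    (\<forall>\<^sub>F t in sequentially. \<not> symbolic_power R I (s * t) \<subseteq> ideal_power R I (r * t))}"

text \<open>
  The ring is a separate argument because the facet ideal of a contraction of \<open>M\<close> is regarded
  as an ideal of the polynomial ring over the ground set of \<open>M\<close>.
\<close>

definition facet_ideal ::
    "('e, 'k::field) mpoly ring \<Rightarrow> 'e matroid_data \<Rightarrow> ('e, 'k) mpoly set" where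
  "facet_ideal R M = Idl\<^bsub>R\<^esub> (sqfree_monom ` bases M)"

end

theory Submission
  imports Defs
begin

text \<open>
  For a squarefree monomial ideal the minimal primes are the coordinate primes of the minimal
  transversals, so \<open>x\<^sup>m\<close> lies in the \<open>s\<close>-th symbolic power of \<open>I(M/U)\<close> iff \<open>m(C) \<ge> s\<close> for all
  transversals \<open>C\<close> of the bases of \<open>M/U\<close>; these are the sets \<open>C\<close> with
  \<open>rk((E - C) \<union> U) < k\<close> and depend on the closure of \<open>U\<close> only, which accounts for the equality of
  the three maxima. By Edmonds' basis packing theorem, \<open>x\<^sup>m\<close> lies in \<open>I(M)\<^sup>r\<close> iff
  \<open>m(E - U) \<ge> r (k - rk U)\<close> for all \<open>U\<close>. Hence \<open>I(M)\<close> has its \<open>s\<close>-th symbolic power contained in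
  its \<open>r\<close>-th power iff \<open>r (k - rk U)\<close> is at most the initial degree of the \<open>s\<close>-th symbolic power
  of \<open>I(M/U)\<close>, for every \<open>U\<close> with \<open>rk U < k\<close>. These degrees are subadditive in \<open>s\<close>; dividing by
  \<open>s\<close> and letting \<open>s\<close> grow gives the formula.
\<close>

section \<open>Matroid rank\<close>

text \<open>Basis packing is an integral statement, so the containment criterion is exact for each
  pair \<open>s\<close>, \<open>r\<close>, and no integral closure has to be taken before passing to
  the limit. By Fekete's lemma the Waldschmidt constant is both a limit and an infimum, and the two
  halves of the formula use different aspects. The infimum bounds the degrees for every positive
  exponent: a quotient \<open>s / r\<close> above the maximum gives containment for each positive
  \<open>t\<close>, against failure for all large \<open>t\<close>. The limit handles a quotient
  below the maximum: a single \<open>U\<close> attaining the maximum violates the criterion for all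
  large \<open>t\<close>. Sets \<open>U\<close> of full rank are left out because their inequality
  is void, while \<open>M/U\<close> then has the empty basis only, no transversals and Waldschmidt
  constant 0, so that the ratio would be meaningless.\<close>

context matroid
begin

lemma finite_bases: "finite (bases M)"
  by (rule finite_subset[of _ "Pow (ground M)"]) (use bases_subset finite_ground in auto)

lemma finite_basis: "B \<in> bases M \<Longrightarrow> finite B"
  using bases_subset finite_ground finite_subset by blast

text \<open>Each exchange preserves the size of \<open>B\<close> and brings it closer to
  \<open>B'\<close>. Once \<open>B \<subseteq> B'\<close>, an element of \<open>B' - B\<close> would
  need an exchange partner in \<open>B - B'\<close>, and there is none.\<close>

lemma card_bases_eq:
  assumes "B \<in> bases M" "B' \<in> bases M"
  shows "card B = card B'"
  using assms
proof (induction "card (B - B')" arbitrary: B rule: less_induct)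
  case less
  show ?case
  proof (cases "B \<subseteq> B'")
    case True
    have "B' \<subseteq> B"
    proof
      fix x assume "x \<in> B'"
      then show "x \<in> B" using basis_exchange[OF less.prems(2,1), of x] True by blast
    qed
    then show ?thesis using True by auto
  next
    case False
    then obtain x where x: "x \<in> B - B'" by blast
    obtain y where y: "y \<in> B' - B" "insert y (B - {x}) \<in> bases M"
      using basis_exchange[OF less.prems x] by blast
    have "insert y (B - {x}) - B' = (B - B') - {x}" using y by auto
    moreover have "card ((B - B') - {x}) < card (B - B')"
      using x finite_basis[OF less.prems(1)] by (intro psubset_card_mono) auto
    ultimately have "card (insert y (B - {x})) = card B'"
      using less.hyps[of "insert y (B - {x})"] y(2) less.prems(2) by simp
    moreover have "card (insert y (B - {x})) = card B"
      using x y finite_basis[OF less.prems(1)] card_Suc_Diff1[of B x] by auto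
    ultimately show ?thesis by simp
  qed
qed

text \<open>Elements of \<open>B1\<close> outside \<open>I \<union> B\<close> are exchanged one by
  one for elements of \<open>B\<close>; no element of \<open>I\<close> is ever removed.\<close>

lemma extend_to_basis:
  assumes "B1 \<in> bases M" "I \<subseteq> B1" "B \<in> bases M"
  obtains B' where "B' \<in> bases M" "I \<subseteq> B'" "B' \<subseteq> I \<union> B"
  using assms
proof (induction "card (B1 - (I \<union> B))" arbitrary: B1 thesis rule: less_induct)
  case less
  show ?case
  proof (cases "B1 \<subseteq> I \<union> B")
    case True
    then show ?thesis using less.prems by blast
  next
    case False
    then obtain x where x: "x \<in> B1 - (I \<union> B)" by blast
    obtain y where y: "y \<in> B - B1" "insert y (B1 - {x}) \<in> bases M"
      using basis_exchange[OF less.prems(2,4), of x] x by blast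
    have "card (insert y (B1 - {x}) - (I \<union> B)) < card (B1 - (I \<union> B))"
      using x y finite_basis[OF less.prems(2)] by (intro psubset_card_mono) auto
    moreover have "I \<subseteq> insert y (B1 - {x})" using x less.prems(3) by auto
    ultimately show ?thesis
      using less.hyps[of "insert y (B1 - {x})" thesis] y(2) less.prems(1,4) by blast
  qed
qed

lemma card_Int_le_rk: "B \<in> bases M \<Longrightarrow> card (U \<inter> B) \<le> rk M U"
  unfolding rk_def by (rule Max_ge) (use finite_bases in auto)

lemma rk_attained: obtains B where "B \<in> bases M" "card (U \<inter> B) = rk M U"
proof -
  have "rk M U \<in> (\<lambda>B. card (U \<inter> B)) ` bases M"
    unfolding rk_def by (rule Max_in) (use finite_bases bases_nonempty in auto)
  then show ?thesis using that by auto
qed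

lemma rk_mono: "U \<subseteq> V \<Longrightarrow> rk M U \<le> rk M V"
proof -
  assume "U \<subseteq> V"
  obtain B where B: "B \<in> bases M" "card (U \<inter> B) = rk M U" by (rule rk_attained)
  then have "card (U \<inter> B) \<le> card (V \<inter> B)"
    using \<open>U \<subseteq> V\<close> finite_basis[OF B(1)] by (intro card_mono) auto
  then show ?thesis using B card_Int_le_rk[OF B(1), of V] by simp
qed

lemma rk_empty [simp]: "rk M {} = 0"
  by (rule rk_attained[of "{}"]) simp

lemma rk_le_card: "finite U \<Longrightarrow> rk M U \<le> card U"
proof -
  assume "finite U"
  obtain B where "card (U \<inter> B) = rk M U" by (rule rk_attained)
  then show ?thesis using card_mono[OF \<open>finite U\<close>, of "U \<inter> B"] by simp
qed

lemma card_basis: "B \<in> bases M \<Longrightarrow> card B = rk M (ground M)"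
  by (metis bases_subset card_bases_eq inf.absorb2 rk_attained)

lemma rk_le: "rk M U \<le> rk M (ground M)"
proof -
  obtain B where B: "B \<in> bases M" "card (U \<inter> B) = rk M U" by (rule rk_attained)
  then show ?thesis using card_basis[OF B(1)] card_mono[OF finite_basis[OF B(1)], of "U \<inter> B"]
    by simp
qed

lemma rk_full_iff: "rk M U = rk M (ground M) \<longleftrightarrow> (\<exists>B\<in>bases M. B \<subseteq> U)"
proof
  assume *: "rk M U = rk M (ground M)"
  obtain B where B: "B \<in> bases M" "card (U \<inter> B) = rk M U" by (rule rk_attained)
  then have "U \<inter> B = B"
    using * card_basis[OF B(1)] finite_basis[OF B(1)] by (intro card_subset_eq) auto
  then show "\<exists>B\<in>bases M. B \<subseteq> U" using B by blast
next
  assume "\<exists>B\<in>bases M. B \<subseteq> U"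
  then obtain B where B: "B \<in> bases M" "B \<subseteq> U" by blast
  then have "rk M (ground M) \<le> rk M U"
    using card_Int_le_rk[OF B(1), of U] card_basis[OF B(1)] by (simp add: Int_absorb1)
  then show "rk M U = rk M (ground M)" using rk_le[of U] by simp
qed

text \<open>Extending \<open>I\<close> from a basis \<open>B2\<close> that attains the rank of
  \<open>U\<close> adds nothing outside \<open>U\<close> beyond elements of \<open>B2\<close>. Since
  all bases have equal size, the loss can only be outside \<open>U\<close>.\<close>

lemma extend_attaining_rk:
  assumes "B1 \<in> bases M" "I \<subseteq> B1" "I \<subseteq> U"
  obtains B where "B \<in> bases M" "I \<subseteq> B" "card (U \<inter> B) = rk M U"
proof -
  obtain B2 where B2: "B2 \<in> bases M" "card (U \<inter> B2) = rk M U" by (rule rk_attained)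
  obtain B where B: "B \<in> bases M" "I \<subseteq> B" "B \<subseteq> I \<union> B2"
    by (rule extend_to_basis[OF assms(1,2) B2(1)])
  have "card B = card (U \<inter> B) + card (B - U)" "card B2 = card (U \<inter> B2) + card (B2 - U)"
    using card_Int_Diff[OF finite_basis[OF B(1)], of U] card_Int_Diff[OF finite_basis[OF B2(1)], of U]
    by (simp_all add: Int_commute)
  moreover have "card (B - U) \<le> card (B2 - U)"
    using B(3) assms(3) finite_basis[OF B2(1)] by (intro card_mono) auto
  ultimately have "rk M U \<le> card (U \<inter> B)"
    using B2 card_bases_eq[OF B(1) B2(1)] by simp
  then show ?thesis using that B card_Int_le_rk[OF B(1), of U] by simp
qed

text \<open>One basis can attain the rank of the union while meeting the intersection in at least
  its rank; on that basis the inequality is the modularity of cardinality.\<close>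

lemma rk_submodular: "rk M (X \<union> Y) + rk M (X \<inter> Y) \<le> rk M X + rk M Y"
proof -
  obtain B1 where B1: "B1 \<in> bases M" "card (X \<inter> Y \<inter> B1) = rk M (X \<inter> Y)" by (rule rk_attained)
  obtain B where B: "B \<in> bases M" "X \<inter> Y \<inter> B1 \<subseteq> B" "card ((X \<union> Y) \<inter> B) = rk M (X \<union> Y)"
    by (rule extend_attaining_rk[OF B1(1), of "X \<inter> Y \<inter> B1" "X \<union> Y"]) auto
  have fin: "finite B" by (rule finite_basis[OF B(1)])
  have "card (X \<inter> Y \<inter> B1) \<le> card ((X \<inter> B) \<inter> (Y \<inter> B))"
    using B(2) fin by (intro card_mono) auto
  moreover have "(X \<union> Y) \<inter> B = (X \<inter> B) \<union> (Y \<inter> B)" by auto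
  moreover have "card (X \<inter> B) + card (Y \<inter> B) = card ((X \<inter> B) \<union> (Y \<inter> B)) + card ((X \<inter> B) \<inter> (Y \<inter> B))"
    using fin by (intro card_Un_Int) auto
  ultimately show ?thesis
    using B B1 card_Int_le_rk[OF B(1), of X] card_Int_le_rk[OF B(1), of Y] by simp
qed

text \<open>\<open>V\<close> lies in the closure of \<open>W\<close>, hence in the closure of every
  \<open>X\<close> above \<open>W\<close>. This is what makes contractions by \<open>W\<close> and
  by \<open>V\<close> indistinguishable through their transversals.\<close>

lemma rk_Un_eq:
  assumes "W \<subseteq> V" "rk M W = rk M V" "W \<subseteq> X"
  shows "rk M (X \<union> V) = rk M X"
proof -
  have "rk M W \<le> rk M (X \<inter> V)" using assms by (intro rk_mono) auto
  then have "rk M (X \<union> V) \<le> rk M X" using rk_submodular[of X V] assms(2) by simp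
  moreover have "rk M X \<le> rk M (X \<union> V)" by (rule rk_mono) auto
  ultimately show ?thesis by simp
qed

lemma rk_indep: "A \<in> indep_sets M \<Longrightarrow> rk M A = card A"
proof -
  assume "A \<in> indep_sets M"
  then obtain B where B: "B \<in> bases M" "A \<subseteq> B" unfolding indep_sets_def by auto
  then have "card A \<le> rk M A" using card_Int_le_rk[OF B(1), of A] by (simp add: Int_absorb2)
  then show ?thesis using rk_le_card[of A] B finite_basis finite_subset by (metis le_antisym)
qed

lemma indep_attaining_rk:
  obtains I where "I \<in> indep_sets M" "I \<subseteq> U" "card I = rk M U"
  by (rule rk_attained[of U]) (use that in \<open>unfold indep_sets_def, blast\<close>)

lemma flat_attaining_rk:
  assumes "U \<subseteq> ground M"
  obtains F where "F \<in> flats M" "U \<subseteq> F" "rk M F = rk M U"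
proof -
  let ?\<F> = "{F. U \<subseteq> F \<and> F \<subseteq> ground M \<and> rk M F = rk M U}"
  have "finite ?\<F>" by (rule finite_subset[of _ "Pow (ground M)"]) (use finite_ground in auto)
  moreover have "U \<in> ?\<F>" using assms by auto
  ultimately obtain F where F: "F \<in> ?\<F>" and max: "\<forall>G\<in>?\<F>. F \<subseteq> G \<longrightarrow> F = G"
    using finite_has_maximal[of ?\<F>] by (metis (no_types, lifting) empty_iff)
  have "G = F" if "F \<subseteq> G" "G \<subseteq> ground M" "rk M G = rk M F" for G
    using max[rule_format, of G] F that by auto
  then have "F \<in> flats M" using F unfolding flats_def by blast
  then show ?thesis using that F by blast
qed

text \<open>Some basis of the contraction avoids \<open>C\<close> exactly when
  \<open>(ground M - C) \<union> U\<close> contains a basis of \<open>M\<close>, that is, has full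
  rank.\<close>

lemma contraction_transversal_iff:
  assumes "U \<subseteq> ground M" "C \<subseteq> ground M"
  shows "(\<forall>B\<in>bases (contraction M U). C \<inter> B \<noteq> {}) \<longleftrightarrow>
    rk M ((ground M - C) \<union> U) < rk M (ground M)"
proof -
  have "(\<exists>B\<in>bases (contraction M U). C \<inter> B = {}) \<longleftrightarrow>
    (\<exists>B\<in>bases M. B \<subseteq> (ground M - C) \<union> U)" (is "?L \<longleftrightarrow> ?R")
  proof
    assume ?L
    then obtain B B' where "C \<inter> B = {}" "B \<subseteq> ground M - U" "B' \<subseteq> U" "B \<union> B' \<in> bases M"
      unfolding contraction_def restriction_def by auto
    then show ?R by (intro bexI[of _ "B \<union> B'"]) auto
  next
    assume ?R
    then obtain B0 where B0: "B0 \<in> bases M" "B0 \<subseteq> (ground M - C) \<union> U" by blast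
    \<comment> \<open>A basis inside \<open>(ground M - C) \<union> U\<close> may meet
      \<open>U\<close> in too few elements to yield a basis of the contraction. Starting from a
      rank-attaining part of \<open>U\<close> and completing it from \<open>B0\<close> makes
      \<open>B \<inter> U\<close> maximal independent in \<open>U\<close>.\<close>
    obtain B1 where B1: "B1 \<in> bases M" "card (U \<inter> B1) = rk M U" by (rule rk_attained)
    obtain B where B: "B \<in> bases M" "U \<inter> B1 \<subseteq> B" "B \<subseteq> U \<inter> B1 \<union> B0"
      by (rule extend_to_basis[OF B1(1) _ B0(1), of "U \<inter> B1"]) auto
    have "A = B \<inter> U" if A: "B \<inter> U \<subseteq> A" "A \<subseteq> U" "A \<in> indep_sets M" for A
    proof -
      have "card A \<le> card (U \<inter> B1)" using rk_indep[OF A(3)] rk_mono[OF A(2)] B1(2) by simp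
      also have "\<dots> \<le> card (B \<inter> U)"
        using B(2) finite_basis[OF B(1)] by (intro card_mono) auto
      finally show ?thesis
        using A finite_subset[OF A(2)] finite_subset[OF assms(1) finite_ground]
        by (metis card_seteq)
    qed
    then have "B \<inter> U \<in> bases (restriction M U)"
      using B(1) unfolding restriction_def indep_sets_def by auto
    moreover have "(B - U) \<union> (B \<inter> U) \<in> bases M" using B(1) by (simp add: Un_Diff_Int)
    ultimately have "B - U \<in> bases (contraction M U)"
      using bases_subset[OF B(1)] unfolding contraction_def by auto
    moreover have "C \<inter> (B - U) = {}" using B(3) B0(2) by auto
    ultimately show ?L by blast
  qed
  then show ?thesis using rk_full_iff[of "(ground M - C) \<union> U"] rk_le[of "(ground M - C) \<union> U"]
    by (metis order.strict_iff_order)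
qed

end

section \<open>Basis packing\<close>

text \<open>Rado's theorem for a monotone submodular \<open>f\<close>. When all \<open>A i\<close>
  are singletons the Hall condition is the claim; otherwise some \<open>A i\<close> has two
  elements, and one of them can be deleted without violating the condition.\<close>

lemma rado_selection:
  fixes f :: "'a set \<Rightarrow> nat" and A :: "'i \<Rightarrow> 'a set"
  assumes fin: "finite I" "\<And>i. i \<in> I \<Longrightarrow> finite (A i)"
    and f_empty: "f {} = 0"
    and f_mono: "\<And>X Y. finite Y \<Longrightarrow> X \<subseteq> Y \<Longrightarrow> f X \<le> f Y"
    and f_submod: "\<And>X Y. finite X \<Longrightarrow> finite Y \<Longrightarrow> f (X \<union> Y) + f (X \<inter> Y) \<le> f X + f Y"
    and hall: "\<And>J. J \<subseteq> I \<Longrightarrow> card J \<le> f (\<Union>i\<in>J. A i)"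
  obtains c where "\<And>i. i \<in> I \<Longrightarrow> c i \<in> A i" "\<And>J. J \<subseteq> I \<Longrightarrow> card J \<le> f (c ` J)"
  using fin(2) hall
proof (induction "\<Sum>i\<in>I. card (A i)" arbitrary: A thesis rule: less_induct)
  case less
  note finA = less.prems(2) and hall = less.prems(3)
  have finU: "finite (\<Union>i\<in>J. A i)" if "J \<subseteq> I" for J
    using that finA fin(1) finite_subset by blast
  have ne: "A i \<noteq> {}" if "i \<in> I" for i
  proof
    assume "A i = {}"
    then show False using hall[of "{i}"] that f_empty by simp
  qed
  show ?case
  proof (cases "\<forall>i\<in>I. card (A i) = 1")
    case True
    define c where "c i = the_elem (A i)" for i
    have c: "A i = {c i}" if "i \<in> I" for i
      using True that unfolding c_def by (metis card_1_singletonE the_elem_eq)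
    have "(\<Union>i\<in>J. A i) = c ` J" if "J \<subseteq> I" for J using c that by auto
    then show ?thesis using less.prems(1)[of c] c hall by auto
  next
    case False
    then obtain i where i: "i \<in> I" "card (A i) \<noteq> 1" by blast
    then obtain x where x: "x \<in> A i" using ne by blast
    have "A i \<noteq> {x}" using i by auto
    then obtain y where y: "y \<in> A i" "y \<noteq> x" using x by blast
    define A' where "A' z = A(i := A i - {z})" for z
    have "\<exists>z\<in>{x, y}. \<forall>J\<subseteq>I. card J \<le> f (\<Union>j\<in>J. A' z j)"
    proof (rule ccontr)
      assume "\<not> ?thesis"
      then obtain Jx Jy where J: "Jx \<subseteq> I" "f (\<Union>j\<in>Jx. A' x j) < card Jx"
        "Jy \<subseteq> I" "f (\<Union>j\<in>Jy. A' y j) < card Jy"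
        by (metis insertCI not_le)
      have mem: "i \<in> J" if "J \<subseteq> I" "f (\<Union>j\<in>J. A' z j) < card J" for J z
      proof (rule ccontr)
        assume "i \<notin> J"
        then have "(\<Union>j\<in>J. A' z j) = (\<Union>j\<in>J. A j)" unfolding A'_def by auto
        then show False using that hall[of J] by simp
      qed
      have ix: "i \<in> Jx" "i \<in> Jy" using mem J by blast+
      let ?X = "\<Union>j\<in>Jx. A' x j" and ?Y = "\<Union>j\<in>Jy. A' y j"
      have finXY: "finite ?X" "finite ?Y"
        using J finU finA fin(1) unfolding A'_def
        by (auto intro!: finite_UN_I dest: finite_subset)
      \<comment> \<open>As \<open>x\<close> and \<open>y\<close> differ, the two reduced families
        together recover all of \<open>A i\<close>, so the union loses nothing; the intersection
        loses only the index \<open>i\<close>. Submodularity then costs 1 in total, whereas two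
        strict violations require 2.\<close>
      have "(\<Union>j\<in>Jx \<union> Jy. A j) \<subseteq> ?X \<union> ?Y"
        using ix y unfolding A'_def by (auto split: if_splits)
      then have "card (Jx \<union> Jy) \<le> f (?X \<union> ?Y)"
        using J by (intro order.trans[OF hall f_mono] finite_UnI finXY) auto
      moreover have "(\<Union>j\<in>Jx \<inter> Jy - {i}. A j) \<subseteq> ?X \<inter> ?Y"
        unfolding A'_def by auto
      then have "card (Jx \<inter> Jy - {i}) \<le> f (?X \<inter> ?Y)"
        using J by (intro order.trans[OF hall f_mono] finite_Int disjI1 finXY) auto
      moreover have "card (Jx \<union> Jy) + card (Jx \<inter> Jy) = card Jx + card Jy"
        using J fin(1) by (metis card_Un_Int finite_subset)
      moreover have "card (Jx \<inter> Jy) = Suc (card (Jx \<inter> Jy - {i}))"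
        using ix J fin(1) by (metis IntI card_Suc_Diff1 finite_Int finite_subset)
      ultimately show False using f_submod[OF finXY] J by linarith
    qed
    then obtain z where z: "z \<in> A i" and hallz: "\<forall>J\<subseteq>I. card J \<le> f (\<Union>j\<in>J. A' z j)"
      using x y by blast
    have "(\<Sum>j\<in>I. card (A' z j)) < (\<Sum>j\<in>I. card (A j))"
    proof (rule sum_strict_mono_ex1[OF fin(1)])
      show "\<forall>j\<in>I. card (A' z j) \<le> card (A j)"
        using finA unfolding A'_def by (auto intro: card_mono)
      have "card (A' z i) < card (A i)"
        using card_Diff1_less[OF finA[OF i(1)] z] unfolding A'_def fun_upd_same .
      then show "\<exists>j\<in>I. card (A' z j) < card (A j)" using i(1) by blast
    qed
    moreover have "finite (A' z j)" if "j \<in> I" for j using finA that unfolding A'_def by auto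
    ultimately obtain c where c: "\<And>j. j \<in> I \<Longrightarrow> c j \<in> A' z j" "\<And>J. J \<subseteq> I \<Longrightarrow> card J \<le> f (c ` J)"
      using less.hyps[of "A' z"] hallz by blast
    have "c j \<in> A j" if "j \<in> I" for j using c(1)[OF that] unfolding A'_def by (auto split: if_splits)
    then show ?thesis using less.prems(1)[of c] c(2) by blast
  qed
qed

context matroid
begin

text \<open>
  Take \<open>m e\<close> copies of each element \<open>e\<close> and apply Rado's theorem to the choice of a colour in
  \<open>{..r}\<close> for every copy: the colours below \<open>r\<close> are the bases, and \<open>r\<close> is the colour of the copies
  left over, whose number is capped by the truncated cardinality in \<open>f\<close>.
\<close>

lemma basis_packing:
  fixes m :: "'e \<Rightarrow> nat"
  assumes "\<And>U. U \<subseteq> ground M \<Longrightarrow>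
    r * (rk M (ground M) - rk M U) \<le> (\<Sum>e\<in>ground M - U. m e)"
  obtains \<B> where "\<And>i. i < r \<Longrightarrow> \<B> i \<in> bases M"
    "\<And>e. e \<in> ground M \<Longrightarrow> card {i. i < r \<and> e \<in> \<B> i} \<le> m e"
proof -
  let ?E = "ground M" and ?k = "rk M (ground M)"
  define P where "P = Sigma ?E (\<lambda>e. {..<m e})"
  have finP: "finite P" using finite_ground unfolding P_def by auto
  have cardP: "card P = (\<Sum>e\<in>?E. m e)" using finite_ground unfolding P_def by simp
  \<comment> \<open>\<open>N\<close> is the number of copies left over once \<open>r\<close>
    disjoint sets of \<open>?k\<close> copies have been taken.\<close>
  define N where "N = card P - r * ?k"
  have N: "card P = N + r * ?k" using assms[of "{}"] cardP unfolding N_def by simp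
  define sec :: "(('e \<times> nat) \<times> nat) set \<Rightarrow> nat \<Rightarrow> 'e set" where
    "sec X i = {e. \<exists>j. ((e, j), i) \<in> X}" for X i
  define rest :: "(('e \<times> nat) \<times> nat) set \<Rightarrow> ('e \<times> nat) set" where
    "rest X = {p. (p, r) \<in> X}" for X
  \<comment> \<open>This is the rank function of a direct sum: \<open>r\<close> copies of
    \<open>M\<close>, one for each colour and with repeated elements parallel, and a uniform matroid
    of rank \<open>N\<close> for the colour \<open>r\<close>.\<close>
  define f where "f X = (\<Sum>i<r. rk M (sec X i)) + min (card (rest X)) N" for X
  have rest_sub: "rest X \<subseteq> fst ` X" for X unfolding rest_def by force
  have fin_rest: "finite (rest X)" if "finite X" for X using that rest_sub finite_subset by blast
  have f_empty: "f {} = 0" unfolding f_def sec_def rest_def by simp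
  have f_mono: "f X \<le> f Y" if "finite Y" "X \<subseteq> Y" for X Y
  proof -
    have "rk M (sec X i) \<le> rk M (sec Y i)" for i
      using that by (intro rk_mono) (auto simp: sec_def)
    moreover have "card (rest X) \<le> card (rest Y)"
      using that fin_rest by (intro card_mono) (auto simp: rest_def)
    ultimately show ?thesis unfolding f_def by (intro add_mono sum_mono min.mono) auto
  qed
  have f_submod: "f (X \<union> Y) + f (X \<inter> Y) \<le> f X + f Y" if fin: "finite X" "finite Y" for X Y
  proof -
    have "rk M (sec (X \<union> Y) i) + rk M (sec (X \<inter> Y) i) \<le> rk M (sec X i) + rk M (sec Y i)" for i
    proof -
      have "sec (X \<union> Y) i = sec X i \<union> sec Y i" by (auto simp: sec_def)
      moreover have "rk M (sec (X \<inter> Y) i) \<le> rk M (sec X i \<inter> sec Y i)"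
        by (intro rk_mono) (auto simp: sec_def)
      ultimately show ?thesis using rk_submodular[of "sec X i" "sec Y i"] by simp
    qed
    then have "(\<Sum>i<r. rk M (sec (X \<union> Y) i)) + (\<Sum>i<r. rk M (sec (X \<inter> Y) i))
      \<le> (\<Sum>i<r. rk M (sec X i)) + (\<Sum>i<r. rk M (sec Y i))"
      by (simp add: sum_mono flip: sum.distrib)
    moreover have "card (rest (X \<union> Y)) + card (rest (X \<inter> Y)) = card (rest X) + card (rest Y)"
      using card_Un_Int[OF fin_rest fin_rest, OF fin]
      unfolding rest_def by (simp add: Collect_disj_eq Collect_conj_eq)
    \<comment> \<open>Cardinality is modular and monotone; both are used for it to remain submodular
      after being capped at \<open>N\<close>.\<close>
    moreover have "card (rest (X \<inter> Y)) \<le> card (rest X)" "card (rest (X \<inter> Y)) \<le> card (rest Y)"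
      using fin fin_rest by (auto intro!: card_mono simp: rest_def)
    ultimately show ?thesis unfolding f_def min_def by auto
  qed
  define A :: "'e \<times> nat \<Rightarrow> (('e \<times> nat) \<times> nat) set" where "A p = {p} \<times> {..r}" for p
  have hall: "card J \<le> f (\<Union>p\<in>J. A p)" if J: "J \<subseteq> P" for J
  proof -
    have eq: "sec (\<Union>p\<in>J. A p) i = fst ` J" if "i < r" for i
      using that unfolding sec_def A_def by force
    have "rest (\<Union>p\<in>J. A p) = J" unfolding rest_def A_def by auto
    with eq have f: "f (\<Union>p\<in>J. A p) = r * rk M (fst ` J) + min (card J) N" unfolding f_def by simp
    have sub: "fst ` J \<subseteq> ?E" using J unfolding P_def by auto
    \<comment> \<open>If the cap is inactive the bound is trivial. Otherwise
      \<open>card J \<le> r * rk M U + N\<close> is needed, where \<open>U\<close> consists of the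
      elements under \<open>J\<close>; this is the packing hypothesis for \<open>U\<close>, since
      the copies outside \<open>U\<close> are not in \<open>J\<close>.\<close>
    have "card J \<le> card (Sigma (fst ` J) (\<lambda>e. {..<m e}))"
      using J finP sub finite_subset[OF sub finite_ground] unfolding P_def
      by (intro card_mono) force+
    also have "\<dots> = (\<Sum>e\<in>fst ` J. m e)" using finite_subset[OF sub finite_ground] by simp
    finally have "card J + (\<Sum>e\<in>?E - fst ` J. m e) \<le> card P"
      using sum.subset_diff[OF sub finite_ground, of m] cardP by simp
    then have "card J + r * (?k - rk M (fst ` J)) \<le> N + r * ?k"
      using assms[OF sub] N by linarith
    moreover have "r * (?k - rk M (fst ` J)) + r * rk M (fst ` J) = r * ?k"
      using rk_le[of "fst ` J"] by (simp flip: distrib_left)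
    ultimately show ?thesis unfolding f min_def by auto
  qed
  obtain c where c: "\<And>p. p \<in> P \<Longrightarrow> c p \<in> A p" "\<And>J. J \<subseteq> P \<Longrightarrow> card J \<le> f (c ` J)"
    by (rule rado_selection[where I = P and A = A and f = f])
      (use finP f_empty f_mono f_submod hall in \<open>auto simp: A_def\<close>)
  define D where "D i = {p \<in> P. snd (c p) = i}" for i
  have c_D: "c ` D i = (\<lambda>p. (p, i)) ` D i" for i
    using c(1) unfolding D_def A_def by (intro image_cong) force+
  have D_sub: "D i \<subseteq> P" for i unfolding D_def by auto
  \<comment> \<open>On the copies of a single colour all other summands of \<open>f\<close> vanish,
    so the selection bound says that they number at most the rank of the elements beneath
    them.\<close>
  have D_rk: "card (D i) \<le> rk M (fst ` D i)" if "i < r" for i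
  proof -
    have "sec (c ` D i) j = (if j = i then fst ` D i else {})" for j
      unfolding c_D sec_def by force
    then have "(\<Sum>j<r. rk M (sec (c ` D i) j)) = (\<Sum>j<r. if j = i then rk M (fst ` D i) else 0)"
      by (intro sum.cong) simp_all
    also have "\<dots> = rk M (fst ` D i)" using that by simp
    finally have "(\<Sum>j<r. rk M (sec (c ` D i) j)) = rk M (fst ` D i)" .
    moreover have "rest (c ` D i) = {}" using that unfolding c_D rest_def by blast
    ultimately have "f (c ` D i) = rk M (fst ` D i)" unfolding f_def by simp
    then show ?thesis using c(2)[OF D_sub[of i]] by (simp only:)
  qed
  have D_rest: "card (D r) \<le> N"
  proof -
    have "sec (c ` D r) j = {}" if "j < r" for j using that unfolding c_D sec_def by blast
    then have "f (c ` D r) \<le> N" unfolding f_def by simp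
    then show ?thesis using c(2)[OF D_sub[of r]] by linarith
  qed
  have D_le: "card (D i) \<le> ?k" if "i < r" for i
    using D_rk[OF that] rk_le[of "fst ` D i"] by simp
  \<comment> \<open>At most \<open>N\<close> copies have colour \<open>r\<close>, so the other
    \<open>r\<close> classes hold at least \<open>r * ?k\<close> copies. Each holds at most
    \<open>?k\<close>, hence exactly \<open>?k\<close>, and so its elements span.\<close>
  have "(\<Union>i\<in>{..r}. D i) = P" using c(1) unfolding D_def A_def by force
  moreover have "card (\<Union>i\<in>{..r}. D i) = (\<Sum>i\<le>r. card (D i))"
    by (rule card_UN_disjoint) (auto simp: D_def finP)
  ultimately have "card P = (\<Sum>i<r. card (D i)) + card (D r)"
    by (simp add: lessThan_Suc_atMost[symmetric])
  then have sum_ge: "r * ?k \<le> (\<Sum>i<r. card (D i))" using N D_rest by simp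
  have D_eq: "card (D i) = ?k" if "i < r" for i
  proof (rule ccontr)
    assume "card (D i) \<noteq> ?k"
    then have "(\<Sum>i<r. card (D i)) < (\<Sum>i<r. ?k)"
      using D_le that by (intro sum_strict_mono_ex1) (auto intro!: bexI[of _ i] simp: le_neq_implies_less)
    then show False using sum_ge by simp
  qed
  have "\<exists>B\<in>bases M. B \<subseteq> fst ` D i" if "i < r" for i
    using rk_full_iff[of "fst ` D i"] D_rk[OF that] D_eq[OF that] rk_le[of "fst ` D i"] by simp
  then obtain \<B> where \<B>: "\<And>i. i < r \<Longrightarrow> \<B> i \<in> bases M" "\<And>i. i < r \<Longrightarrow> \<B> i \<subseteq> fst ` D i"
    by metis
  have le: "card {i. i < r \<and> e \<in> \<B> i} \<le> m e" if e: "e \<in> ?E" for e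
  proof -
    have "\<exists>j<m e. (e, j) \<in> D i" if "i < r" "e \<in> \<B> i" for i
    proof -
      have "e \<in> fst ` D i" using \<B>(2)[OF that(1)] that(2) by blast
      then obtain p where "p \<in> D i" "e = fst p" by blast
      then show ?thesis using D_sub[of i] unfolding P_def by (intro exI[of _ "snd p"]) auto
    qed
    then obtain j where j: "\<And>i. i < r \<and> e \<in> \<B> i \<Longrightarrow> j i < m e \<and> (e, j i) \<in> D i" by metis
    \<comment> \<open>A copy has only one colour, so different bases through \<open>e\<close> use
      different copies of \<open>e\<close>.\<close>
    have "inj_on j {i. i < r \<and> e \<in> \<B> i}"
    proof (rule inj_onI)
      fix i i' assume i: "i \<in> {i. i < r \<and> e \<in> \<B> i}" "i' \<in> {i. i < r \<and> e \<in> \<B> i}" "j i = j i'"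
      then have "(e, j i) \<in> D i" "(e, j i) \<in> D i'" using j[of i] j[of i'] by auto
      then show "i = i'" unfolding D_def by simp
    qed
    then show ?thesis
      using card_inj_on_le[of j "{i. i < r \<and> e \<in> \<B> i}" "{..<m e}"] j by (simp add: image_subset_iff)
  qed
  show ?thesis by (rule that[OF \<B>(1) le])
qed

end

section \<open>Monomial ideals\<close>

text \<open>All ideals in the argument are spanned by monomials, so each is encoded by its
  exponents. Keeping the support condition apart from \<open>W\<close> lets \<open>W\<close> be
  given by inequalities on arbitrary exponents.\<close>

definition monomial_ideal :: "'e set \<Rightarrow> ('e \<Rightarrow>\<^sub>0 nat) set \<Rightarrow> ('e, 'k::field) mpoly set" where
  "monomial_ideal E W = {p. \<forall>m\<in>Poly_Mapping.keys p. Poly_Mapping.keys m \<subseteq> E \<and> m \<in> W}"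

definition up_closed :: "('e \<Rightarrow>\<^sub>0 nat) set \<Rightarrow> bool" where
  "up_closed W \<longleftrightarrow> (\<forall>m\<in>W. \<forall>a. m + a \<in> W)"

lemma keys_add_nat: "Poly_Mapping.keys (a + b) = Poly_Mapping.keys a \<union> Poly_Mapping.keys b"
  for a b :: "'e \<Rightarrow>\<^sub>0 nat"
  by (auto simp: in_keys_iff lookup_add)

lemma monomial_ideal_cong:
  assumes "\<And>m. Poly_Mapping.keys m \<subseteq> E \<Longrightarrow> m \<in> V \<longleftrightarrow> m \<in> W"
  shows "monomial_ideal E V = monomial_ideal E W"
  using assms unfolding monomial_ideal_def by blast

lemma single_in_monomial_ideal_iff:
  "Poly_Mapping.single m c \<in> monomial_ideal E W \<longleftrightarrow>
    c = 0 \<or> Poly_Mapping.keys m \<subseteq> E \<and> m \<in> W"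
  unfolding monomial_ideal_def by auto

lemma zero_in_monomial_ideal [simp]: "0 \<in> monomial_ideal E W"
  unfolding monomial_ideal_def by simp

lemma monomial_ideal_add:
  "p \<in> monomial_ideal E W \<Longrightarrow> q \<in> monomial_ideal E W \<Longrightarrow> p + q \<in> monomial_ideal E W"
  unfolding monomial_ideal_def using keys_add[of p q] by blast

lemma monomial_ideal_uminus: "p \<in> monomial_ideal E W \<Longrightarrow> - p \<in> monomial_ideal E W"
  unfolding monomial_ideal_def by (simp add: in_keys_iff)

lemma monomial_ideal_mult:
  assumes "p \<in> monomial_ideal E V" "q \<in> monomial_ideal E W"
  shows "p * q \<in> monomial_ideal E {v + w | v w. v \<in> V \<and> w \<in> W}"
  unfolding monomial_ideal_def mem_Collect_eq
proof
  fix m assume "m \<in> Poly_Mapping.keys (p * q)"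
  then obtain a b where "m = a + b" "a \<in> Poly_Mapping.keys p" "b \<in> Poly_Mapping.keys q"
    using keys_mult[of p q] by blast
  then show "Poly_Mapping.keys m \<subseteq> E \<and> (\<exists>v w. m = v + w \<and> v \<in> V \<and> w \<in> W)"
    using assms unfolding monomial_ideal_def by (intro conjI exI[of _ a] exI[of _ b]) (auto simp: keys_add_nat)
qed

lemma monomial_ideal_UNIV: "carrier (mpoly_ring K E) = monomial_ideal E UNIV"
  unfolding mpoly_ring_def monomial_ideal_def by simp

lemma monomial_ideal_carrier: "monomial_ideal E W \<subseteq> carrier (mpoly_ring K E)"
  unfolding monomial_ideal_UNIV monomial_ideal_def by auto

lemma mpoly_ring_simps:
  "mult (mpoly_ring K E) = (*)" "one (mpoly_ring K E) = 1"
  "zero (mpoly_ring K E) = 0" "add (mpoly_ring K E) = (+)"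
  unfolding mpoly_ring_def by simp_all

lemma poly_mapping_eq_sum_single:
  fixes p :: "'a \<Rightarrow>\<^sub>0 'b::comm_monoid_add"
  shows "p = (\<Sum>m\<in>Poly_Mapping.keys p. Poly_Mapping.single m (Poly_Mapping.lookup p m))"
  by (rule poly_mapping_eqI) (auto simp: lookup_sum lookup_single when_def in_keys_iff)

lemma mpoly_in_add_closed:
  fixes p :: "'a \<Rightarrow>\<^sub>0 'b::comm_monoid_add"
  assumes "\<And>m c. m \<in> Poly_Mapping.keys p \<Longrightarrow> Poly_Mapping.single m c \<in> Q"
    and "0 \<in> Q" "\<And>f g. f \<in> Q \<Longrightarrow> g \<in> Q \<Longrightarrow> f + g \<in> Q"
  shows "p \<in> Q"
proof -
  have "(\<Sum>m\<in>A. Poly_Mapping.single m (Poly_Mapping.lookup p m)) \<in> Q"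
    if "A \<subseteq> Poly_Mapping.keys p" "finite A" for A
    using that(2,1) by (induction A) (auto intro: assms)
  from this[OF subset_refl finite_keys] show ?thesis by (simp flip: poly_mapping_eq_sum_single)
qed

lemma cring_mpoly_ring: "cring (mpoly_ring K E)"
proof (rule cringI)
  show "abelian_group (mpoly_ring K E)"
  proof (rule abelian_groupI)
    fix x assume "x \<in> carrier (mpoly_ring K E)"
    then show "\<exists>y\<in>carrier (mpoly_ring K E). y \<oplus>\<^bsub>mpoly_ring K E\<^esub> x = \<zero>\<^bsub>mpoly_ring K E\<^esub>"
      unfolding monomial_ideal_UNIV mpoly_ring_simps
      by (intro bexI[of _ "- x"]) (auto intro: monomial_ideal_uminus)
  qed (auto simp: monomial_ideal_UNIV mpoly_ring_simps monomial_ideal_add algebra_simps)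
  show "comm_monoid (mpoly_ring K E)"
  proof (rule comm_monoidI)
    fix x y assume "x \<in> carrier (mpoly_ring K E)" "y \<in> carrier (mpoly_ring K E)"
    then show "x \<otimes>\<^bsub>mpoly_ring K E\<^esub> y \<in> carrier (mpoly_ring K E)"
      unfolding monomial_ideal_UNIV mpoly_ring_simps
      using monomial_ideal_mult[of x E UNIV y UNIV] unfolding monomial_ideal_def by auto
  qed (auto simp: monomial_ideal_UNIV mpoly_ring_simps algebra_simps, auto simp: monomial_ideal_def)
qed (auto simp: mpoly_ring_simps algebra_simps)

lemma ideal_monomial_ideal:
  assumes "up_closed W"
  shows "ideal (monomial_ideal E W) (mpoly_ring K E)"
proof -
  interpret cring "mpoly_ring K E" by (rule cring_mpoly_ring)
  have mult: "x * a \<in> monomial_ideal E W"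
    if "a \<in> monomial_ideal E W" "x \<in> carrier (mpoly_ring K E)" for a x
  proof -
    have "x * a \<in> monomial_ideal E {v + w |v w. v \<in> UNIV \<and> w \<in> W}"
      using that unfolding monomial_ideal_UNIV by (intro monomial_ideal_mult)
    moreover have "{v + w |v w. v \<in> UNIV \<and> w \<in> W} \<subseteq> W"
      using assms unfolding up_closed_def by (subst add.commute) blast
    ultimately show ?thesis unfolding monomial_ideal_def by blast
  qed
  show ?thesis
  proof (rule idealI)
    show "subgroup (monomial_ideal E W) (add_monoid (mpoly_ring K E))"
    proof (rule add.subgroupI)
      fix a :: "('a, 'b) mpoly" assume a: "a \<in> monomial_ideal E W"
      then have "a \<in> carrier (mpoly_ring K E)" "- a \<in> carrier (mpoly_ring K E)"
        using monomial_ideal_carrier monomial_ideal_uminus by blast+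
      then have "\<ominus>\<^bsub>mpoly_ring K E\<^esub> a = - a"
        by (intro minus_equality) (auto simp: mpoly_ring_simps)
      then show "\<ominus>\<^bsub>mpoly_ring K E\<^esub> a \<in> monomial_ideal E W"
        using a monomial_ideal_uminus by auto
    next
      show "monomial_ideal E W \<noteq> {}" using zero_in_monomial_ideal by blast
    qed (auto simp: mpoly_ring_simps monomial_ideal_add monomial_ideal_carrier)
  qed (use mult in \<open>auto simp: mpoly_ring_simps mult.commute ring_axioms\<close>)
qed

lemma ideal_prod_monomial_ideal:
  "ideal_prod (mpoly_ring K E) (monomial_ideal E V) (monomial_ideal E W) =
    monomial_ideal E {v + w | v w. v \<in> V \<and> w \<in> W}"
proof
  show "ideal_prod (mpoly_ring K E) (monomial_ideal E V) (monomial_ideal E W) \<subseteq>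
    monomial_ideal E {v + w | v w. v \<in> V \<and> w \<in> W}"
  proof
    fix p assume "p \<in> ideal_prod (mpoly_ring K E) (monomial_ideal E V) (monomial_ideal E W)"
    then show "p \<in> monomial_ideal E {v + w | v w. v \<in> V \<and> w \<in> W}"
    proof induction
      case (prod i j)
      then show ?case unfolding mpoly_ring_simps by (rule monomial_ideal_mult)
    next
      case (sum s1 s2)
      then show ?case unfolding mpoly_ring_simps by (intro monomial_ideal_add)
    qed
  qed
  show "monomial_ideal E {v + w | v w. v \<in> V \<and> w \<in> W} \<subseteq>
    ideal_prod (mpoly_ring K E) (monomial_ideal E V) (monomial_ideal E W)" (is "_ \<subseteq> ?P")
  proof
    note prod = ideal_prod.prod[where R = "mpoly_ring K E", unfolded mpoly_ring_simps]
    note sum = ideal_prod.sum[where R = "mpoly_ring K E", unfolded mpoly_ring_simps]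
    fix p :: "('a, 'b) mpoly"
    assume p: "p \<in> monomial_ideal E {v + w | v w. v \<in> V \<and> w \<in> W}"
    show "p \<in> ?P"
    proof (rule mpoly_in_add_closed)
      fix m and c :: 'b assume "m \<in> Poly_Mapping.keys p"
      then obtain v w where m: "m = v + w" "v \<in> V" "w \<in> W" "Poly_Mapping.keys m \<subseteq> E"
        using p unfolding monomial_ideal_def by blast
      then have "Poly_Mapping.single v c * Poly_Mapping.single w 1 \<in> ?P"
        by (intro prod) (auto simp: single_in_monomial_ideal_iff keys_add_nat)
      then show "Poly_Mapping.single m c \<in> ?P" using m by (simp add: mult_single)
    next
      have "0 * 0 \<in> ?P" by (intro prod zero_in_monomial_ideal)
      then show "0 \<in> ?P" by simp
    qed (rule sum)
  qed
qed

text \<open>The recursion is the exponent form of multiplying by the ideal once more. Demanding it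
  only for exponents supported in \<open>E\<close> allows closed forms \<open>P\<close> that are
  correct only there.\<close>

lemma ideal_power_monomial_ideal:
  assumes "\<And>m. Poly_Mapping.keys m \<subseteq> E \<Longrightarrow> m \<in> P 0"
    and "\<And>s m. Poly_Mapping.keys m \<subseteq> E \<Longrightarrow>
      m \<in> P (Suc s) \<longleftrightarrow> (\<exists>v w. m = v + w \<and> v \<in> P s \<and> w \<in> W)"
  shows "ideal_power (mpoly_ring K E) (monomial_ideal E W) s = monomial_ideal E (P s)"
proof (induction s)
  case 0
  have "monomial_ideal E UNIV = monomial_ideal E (P 0)"
    using assms(1) by (intro monomial_ideal_cong) auto
  then show ?case by (simp add: nat_pow_def ideals_set_def monomial_ideal_UNIV)
next
  case (Suc s)
  have "ideal_power (mpoly_ring K E) (monomial_ideal E W) (Suc s) =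
    ideal_prod (mpoly_ring K E) (monomial_ideal E (P s)) (monomial_ideal E W)"
    using Suc by (simp add: nat_pow_def ideals_set_def)
  also have "\<dots> = monomial_ideal E (P (Suc s))"
    unfolding ideal_prod_monomial_ideal using assms(2) by (intro monomial_ideal_cong) auto
  finally show ?case .
qed

subsection \<open>Facet ideals and their powers\<close>

definition exp_sum :: "'e set \<Rightarrow> ('e \<Rightarrow>\<^sub>0 nat) \<Rightarrow> nat" where
  "exp_sum C m = (\<Sum>e\<in>C. Poly_Mapping.lookup m e)"

lemma exp_sum_add: "exp_sum C (a + b) = exp_sum C a + exp_sum C b"
  unfolding exp_sum_def by (simp add: lookup_add sum.distrib)

lemma exp_sum_mono: "finite D \<Longrightarrow> C \<subseteq> D \<Longrightarrow> exp_sum C m \<le> exp_sum D m"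
  unfolding exp_sum_def by (rule sum_mono2) auto

lemma minus_plus_single:
  assumes "0 < Poly_Mapping.lookup m e"
  shows "(m - Poly_Mapping.single e 1) + Poly_Mapping.single e 1 = (m :: 'e \<Rightarrow>\<^sub>0 nat)"
  by (rule poly_mapping_eqI) (use assms in \<open>auto simp: lookup_add lookup_minus lookup_single when_def\<close>)

lemma exp_sum_single: "finite C \<Longrightarrow> e \<in> C \<Longrightarrow> exp_sum C (Poly_Mapping.single e 1) = 1"
  unfolding exp_sum_def by (simp add: lookup_single when_def)

lemma var_in_monomial_ideal_iff: "var e \<in> monomial_ideal E W \<longleftrightarrow>
    e \<in> E \<and> Poly_Mapping.single e 1 \<in> W"
  unfolding var_def by (simp add: single_in_monomial_ideal_iff)

text \<open>For \<open>C \<subseteq> E\<close> this is the prime generated by the variables of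
  \<open>C\<close>. In the form of a degree threshold its powers merely raise the bound from 1 to
  \<open>s\<close>.\<close>

definition coord_ideal :: "'e set \<Rightarrow> 'e set \<Rightarrow> ('e, 'k::field) mpoly set" where
  "coord_ideal E C = monomial_ideal E {m. 1 \<le> exp_sum C m}"

lemma ideal_power_coord_ideal:
  assumes "finite C"
  shows "ideal_power (mpoly_ring K E) (coord_ideal E C) s = monomial_ideal E {m. s \<le> exp_sum C m}"
  unfolding coord_ideal_def
proof (rule ideal_power_monomial_ideal)
  fix s m
  show "m \<in> {m. Suc s \<le> exp_sum C m} \<longleftrightarrow>
    (\<exists>v w. m = v + w \<and> v \<in> {m. s \<le> exp_sum C m} \<and> w \<in> {m. 1 \<le> exp_sum C m})"
  proof
    assume m: "m \<in> {m. Suc s \<le> exp_sum C m}"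
    then have "exp_sum C m \<noteq> 0" by auto
    then obtain e where e: "e \<in> C" "0 < Poly_Mapping.lookup m e"
      unfolding exp_sum_def using assms by auto
    let ?e = "Poly_Mapping.single e (1::nat)"
    have "exp_sum C (m - ?e) + exp_sum C ?e = exp_sum C m"
      using minus_plus_single[OF e(2)] by (metis exp_sum_add)
    then show "\<exists>v w. m = v + w \<and> v \<in> {m. s \<le> exp_sum C m} \<and> w \<in> {m. 1 \<le> exp_sum C m}"
      using m minus_plus_single[OF e(2)] exp_sum_single[OF assms e(1)]
      by (intro exI[of _ "m - ?e"] exI[of _ ?e]) simp
  qed (auto simp: exp_sum_add)
qed simp

text \<open>
  In place of leading terms for a monomial order, which would need a linear order on \<open>'e\<close>: maximise
  one coordinate after the other.
\<close>

lemma unique_sum_pair: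
  fixes A B :: "('e \<Rightarrow>\<^sub>0 nat) set"
  assumes "finite V" "finite A" "A \<noteq> {}" "finite B" "B \<noteq> {}"
  obtains a b where "a \<in> A" "b \<in> B" "\<And>a' b'. a' \<in> A \<Longrightarrow> b' \<in> B \<Longrightarrow> a' + b' = a + b \<Longrightarrow>
    \<forall>e\<in>V. Poly_Mapping.lookup a' e = Poly_Mapping.lookup a e \<and>
      Poly_Mapping.lookup b' e = Poly_Mapping.lookup b e"
  using assms
proof (induction V arbitrary: A B thesis)
  case empty
  then show ?case by blast
next
  case (insert e V)
  define top where "top X = {m \<in> X. Poly_Mapping.lookup m e = (MAX m\<in>X. Poly_Mapping.lookup m e)}"
    for X :: "('e \<Rightarrow>\<^sub>0 nat) set"
  have top: "finite (top X)" "top X \<noteq> {}" "top X \<subseteq> X" if "finite X" "X \<noteq> {}" for X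
  proof -
    have "(MAX m\<in>X. Poly_Mapping.lookup m e) \<in> (\<lambda>m. Poly_Mapping.lookup m e) ` X"
      using that by (intro Max_in) auto
    then show "top X \<noteq> {}" unfolding top_def by auto
  qed (use that in \<open>auto simp: top_def\<close>)
  have le: "Poly_Mapping.lookup m e \<le> Poly_Mapping.lookup m' e" if "finite X" "m \<in> X" "m' \<in> top X" for m m' X
    using that unfolding top_def by simp
  have topI: "m \<in> top X" if "m \<in> X" "m' \<in> top X" "Poly_Mapping.lookup m e = Poly_Mapping.lookup m' e" for m m' X
    using that unfolding top_def by simp
  note A = insert.prems(2,3) and B = insert.prems(4,5)
  obtain a b where ab: "a \<in> top A" "b \<in> top B" and
    uniq: "\<And>a' b'. a' \<in> top A \<Longrightarrow> b' \<in> top B \<Longrightarrow> a' + b' = a + b \<Longrightarrow>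
    \<forall>e\<in>V. Poly_Mapping.lookup a' e = Poly_Mapping.lookup a e \<and>
      Poly_Mapping.lookup b' e = Poly_Mapping.lookup b e"
    using insert.IH[OF _ top(1,2)[OF A] top(1,2)[OF B]] by blast
  show ?case
  proof (rule insert.prems(1)[of a b])
    show "a \<in> A" "b \<in> B" using ab top(3)[OF A] top(3)[OF B] by auto
  next
    fix a' b' assume *: "a' \<in> A" "b' \<in> B" "a' + b' = a + b"
    \<comment> \<open>Neither summand can exceed its maximum in the coordinate \<open>e\<close>, so
      equal sums force both to attain it.\<close>
    have "Poly_Mapping.lookup a' e + Poly_Mapping.lookup b' e = Poly_Mapping.lookup a e + Poly_Mapping.lookup b e"
      using *(3) by (metis lookup_add)
    then have eq: "Poly_Mapping.lookup a' e = Poly_Mapping.lookup a e" "Poly_Mapping.lookup b' e = Poly_Mapping.lookup b e"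
      using le[OF A(1) *(1) ab(1)] le[OF B(1) *(2) ab(2)] by linarith+
    then have "a' \<in> top A" "b' \<in> top B" using topI * ab by blast+
    then show "\<forall>e\<in>insert e V. Poly_Mapping.lookup a' e = Poly_Mapping.lookup a e \<and>
      Poly_Mapping.lookup b' e = Poly_Mapping.lookup b e"
      using uniq *(3) eq by blast
  qed
qed

text \<open>If neither factor lies in the ideal, both have terms free of the variables in
  \<open>C\<close>. Among these some pair has an exponent sum reached by no other pair, so its
  coefficient in \<open>f * g\<close> is a nonzero product and its exponent is outside the
  ideal.\<close>

lemma primeideal_coord_ideal:
  assumes "finite E" "C \<subseteq> E"
  shows "primeideal (coord_ideal E C) (mpoly_ring K E)"
proof (rule primeidealI)
  show "ideal (coord_ideal E C) (mpoly_ring K E)"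
    unfolding coord_ideal_def by (rule ideal_monomial_ideal) (auto simp: up_closed_def exp_sum_add)
  show "cring (mpoly_ring K E)" by (rule cring_mpoly_ring)
  have "1 \<in> carrier (mpoly_ring K E)" "1 \<notin> coord_ideal E C"
    unfolding monomial_ideal_UNIV coord_ideal_def monomial_ideal_def exp_sum_def by auto
  then show "carrier (mpoly_ring K E) \<noteq> coord_ideal E C" by blast
  fix f g :: "('a, 'b) mpoly"
  assume f: "f \<in> carrier (mpoly_ring K E)" and g: "g \<in> carrier (mpoly_ring K E)"
  assume "f \<otimes>\<^bsub>mpoly_ring K E\<^esub> g \<in> coord_ideal E C"
  then have fg: "f * g \<in> coord_ideal E C" by (simp add: mpoly_ring_simps)
  show "f \<in> coord_ideal E C \<or> g \<in> coord_ideal E C"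
  proof (rule ccontr)
    assume neither: "\<not> ?thesis"
    define low where "low p = {m \<in> Poly_Mapping.keys p. exp_sum C m = 0}" for p :: "('a, 'b) mpoly"
    have "low f \<noteq> {}" "low g \<noteq> {}"
      using neither f g unfolding coord_ideal_def monomial_ideal_UNIV monomial_ideal_def low_def
      by auto
    then obtain a b where ab: "a \<in> low f" "b \<in> low g" and
      uniq: "\<And>a' b'. a' \<in> low f \<Longrightarrow> b' \<in> low g \<Longrightarrow> a' + b' = a + b \<Longrightarrow>
      \<forall>e\<in>E. Poly_Mapping.lookup a' e = Poly_Mapping.lookup a e \<and>
        Poly_Mapping.lookup b' e = Poly_Mapping.lookup b e"
      using unique_sum_pair[OF assms(1), of "low f" "low g"] unfolding low_def by auto
    have eqI: "m = m'" if "m \<in> Poly_Mapping.keys p" "m' \<in> Poly_Mapping.keys p"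
      "\<forall>e\<in>E. Poly_Mapping.lookup m e = Poly_Mapping.lookup m' e" "p \<in> carrier (mpoly_ring K E)"
      for m m' and p :: "('a, 'b) mpoly"
    proof (rule poly_mapping_eqI)
      fix e
      have "Poly_Mapping.keys m \<subseteq> E" "Poly_Mapping.keys m' \<subseteq> E"
        using that unfolding monomial_ideal_UNIV monomial_ideal_def by auto
      then show "Poly_Mapping.lookup m e = Poly_Mapping.lookup m' e"
        using that(3) by (metis in_keys_iff subsetD)
    qed
    let ?t = "\<lambda>(x, y). Poly_Mapping.lookup f x * Poly_Mapping.lookup g y when a + b = x + y"
    have zero: "?t (x, y) = 0" if "(x, y) \<noteq> (a, b)" for x y
    proof (rule ccontr)
      assume "?t (x, y) \<noteq> 0"
      then have xy: "x \<in> Poly_Mapping.keys f" "y \<in> Poly_Mapping.keys g" "x + y = a + b"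
        by (auto simp: in_keys_iff when_def split: if_splits)
      \<comment> \<open>The degree on \<open>C\<close> is additive and vanishes at \<open>a\<close>
        and \<open>b\<close>. Terms involving variables of \<open>C\<close> therefore cannot
        contribute to this coefficient.\<close>
      have "exp_sum C x + exp_sum C y = exp_sum C a + exp_sum C b"
        using xy(3) by (metis exp_sum_add)
      then have "x \<in> low f" "y \<in> low g" using xy ab unfolding low_def by auto
      from uniq[OF this xy(3)] have "x = a" "y = b"
        using eqI[OF xy(1) _ _ f, of a] eqI[OF xy(2) _ _ g, of b] ab unfolding low_def by auto
      then show False using that by simp
    qed
    have "Poly_Mapping.lookup (f * g) (a + b) = Sum_any ?t"
      unfolding times_poly_mapping.rep_eq by (rule prod_fun_unfold_prod) auto
    also have "\<dots> = sum ?t {(a, b)}"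
      using zero by (intro Sum_any.expand_superset) auto
    also have "\<dots> \<noteq> 0" using ab unfolding low_def by (auto simp: in_keys_iff)
    finally have "a + b \<in> Poly_Mapping.keys (f * g)" by (simp add: in_keys_iff)
    then have "1 \<le> exp_sum C (a + b)" using fg unfolding coord_ideal_def monomial_ideal_def by blast
    then show False using ab unfolding low_def by (simp add: exp_sum_add)
  qed
qed

lemma coord_ideal_subset:
  assumes "ideal Q (mpoly_ring K E)" "finite C" "\<And>e. e \<in> C \<Longrightarrow> var e \<in> Q"
  shows "coord_ideal E C \<subseteq> Q"
proof
  interpret ideal Q "mpoly_ring K E" by fact
  have is_additive_subgroup: "additive_subgroup Q (mpoly_ring K E)" ..
  fix p :: "('a, 'b) mpoly" assume p: "p \<in> coord_ideal E C"
  show "p \<in> Q"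
  proof (rule mpoly_in_add_closed)
    fix m and c :: 'b assume "m \<in> Poly_Mapping.keys p"
    then have m: "Poly_Mapping.keys m \<subseteq> E" "exp_sum C m \<noteq> 0"
      using p unfolding coord_ideal_def monomial_ideal_def by auto
    then obtain e where e: "e \<in> C" "0 < Poly_Mapping.lookup m e"
      unfolding exp_sum_def using assms(2) by auto
    let ?m = "m - Poly_Mapping.single e 1"
    have "Poly_Mapping.keys ?m \<subseteq> E"
      using m(1) minus_plus_single[OF e(2)] by (metis keys_add_nat le_sup_iff)
    then have "Poly_Mapping.single ?m c \<in> carrier (mpoly_ring K E)"
      unfolding monomial_ideal_UNIV by (simp add: single_in_monomial_ideal_iff)
    then have "Poly_Mapping.single ?m c * var e \<in> Q"
      using I_l_closed[OF assms(3)[OF e(1)]] by (simp add: mpoly_ring_simps)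
    then show "Poly_Mapping.single m c \<in> Q"
      unfolding var_def mult_single using minus_plus_single[OF e(2)] by simp
  next
    show "0 \<in> Q" using additive_subgroup.zero_closed[OF is_additive_subgroup] by (simp add: mpoly_ring_simps)
  next
    fix f g assume "f \<in> Q" "g \<in> Q"
    then show "f + g \<in> Q"
      using additive_subgroup.a_closed[OF is_additive_subgroup] by (simp add: mpoly_ring_simps)
  qed
qed

lemma sqfree_monom_eq:
  "finite U \<Longrightarrow> sqfree_monom U = Poly_Mapping.single (\<Sum>e\<in>U. Poly_Mapping.single e 1) 1"
  unfolding sqfree_monom_def by (induction U rule: finite_induct) (auto simp: var_def mult_single)

lemma lookup_indicator:
  "finite U \<Longrightarrow> Poly_Mapping.lookup (\<Sum>e\<in>U. Poly_Mapping.single e (1::nat)) x = (if x \<in> U then 1 else 0)"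
  by (simp add: lookup_sum lookup_single when_def)

lemma facet_ideal_eq:
  assumes "finite E" "bases M \<subseteq> Pow E"
  shows "facet_ideal (mpoly_ring K E) M =
    monomial_ideal E {m. \<exists>B\<in>bases M. \<forall>e\<in>B. 1 \<le> Poly_Mapping.lookup m e}" (is "?I = monomial_ideal E ?W")
proof
  interpret cring "mpoly_ring K E" by (rule cring_mpoly_ring)
  have fin: "finite B" "B \<subseteq> E" if "B \<in> bases M" for B using that assms finite_subset by blast+
  define ind :: "'a set \<Rightarrow> 'a \<Rightarrow>\<^sub>0 nat" where "ind B = (\<Sum>e\<in>B. Poly_Mapping.single e 1)" for B
  have lookup_ind: "Poly_Mapping.lookup (ind B) e = (if e \<in> B then 1 else 0)" if "B \<in> bases M" for B e
    unfolding ind_def using lookup_indicator[OF fin(1)[OF that]] .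
  have sqf: "sqfree_monom B = Poly_Mapping.single (ind B) 1" if "B \<in> bases M" for B
    unfolding ind_def using sqfree_monom_eq[OF fin(1)[OF that]] .
  have gens: "sqfree_monom ` bases M \<subseteq> monomial_ideal E ?W"
  proof clarify
    fix B assume B: "B \<in> bases M"
    have "Poly_Mapping.keys (ind B) \<subseteq> E" using fin(2)[OF B] lookup_ind[OF B]
      by (auto simp: in_keys_iff split: if_splits)
    then show "sqfree_monom B \<in> monomial_ideal E ?W"
      using B lookup_ind[OF B] unfolding sqf[OF B] single_in_monomial_ideal_iff by auto
  qed
  have "ideal (monomial_ideal E ?W) (mpoly_ring K E)"
    by (rule ideal_monomial_ideal) (force simp: up_closed_def lookup_add)
  then show "?I \<subseteq> monomial_ideal E ?W"
    unfolding facet_ideal_def by (rule genideal_minimal[OF _ gens])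
  have carr: "sqfree_monom ` bases M \<subseteq> carrier (mpoly_ring K E)"
    using gens monomial_ideal_carrier by blast
  interpret I: ideal ?I "mpoly_ring K E"
    unfolding facet_ideal_def by (rule genideal_ideal[OF carr])
  have sub: "additive_subgroup ?I (mpoly_ring K E)" ..
  have gen_in: "sqfree_monom ` bases M \<subseteq> ?I"
    unfolding facet_ideal_def by (rule genideal_self[OF carr])
  show "monomial_ideal E ?W \<subseteq> ?I"
  proof
    fix p :: "('a, 'b) mpoly" assume p: "p \<in> monomial_ideal E ?W"
    show "p \<in> ?I"
    proof (rule mpoly_in_add_closed)
      fix m and c :: 'b assume "m \<in> Poly_Mapping.keys p"
      then obtain B where m: "Poly_Mapping.keys m \<subseteq> E"
        and B: "B \<in> bases M" "\<forall>e\<in>B. 1 \<le> Poly_Mapping.lookup m e"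
        using p unfolding monomial_ideal_def by auto
      have eq: "(m - ind B) + ind B = m"
        using B by (intro poly_mapping_eqI) (auto simp: lookup_add lookup_minus lookup_ind)
      then have "Poly_Mapping.keys (m - ind B) \<subseteq> E" using m by (metis keys_add_nat le_sup_iff)
      then have "Poly_Mapping.single (m - ind B) c \<in> carrier (mpoly_ring K E)"
        unfolding monomial_ideal_UNIV by (simp add: single_in_monomial_ideal_iff)
      then have "Poly_Mapping.single (m - ind B) c * sqfree_monom B \<in> ?I"
        using I.I_l_closed[of "sqfree_monom B"] gen_in B(1) by (auto simp: mpoly_ring_simps)
      then show "Poly_Mapping.single m c \<in> ?I" unfolding sqf[OF B(1)] mult_single eq by simp
    next
      show "0 \<in> ?I" using additive_subgroup.zero_closed[OF sub] by (simp add: mpoly_ring_simps)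
    next
      fix f g assume "f \<in> ?I" "g \<in> ?I"
      then show "f + g \<in> ?I"
        using additive_subgroup.a_closed[OF sub] by (simp add: mpoly_ring_simps)
    qed
  qed
qed

text \<open>A monomial is in the power exactly when a product of \<open>r\<close> generators divides
  it. The bases form an indexed family because a generator may be repeated, and the cardinality
  counts how often \<open>e\<close> is used.\<close>

lemma ideal_power_facet_ideal:
  assumes "finite E" "bases M \<subseteq> Pow E"
  shows "ideal_power (mpoly_ring K E) (facet_ideal (mpoly_ring K E) M) r =
    monomial_ideal E {m. \<exists>\<B>. (\<forall>i<r. \<B> i \<in> bases M) \<and>
      (\<forall>e\<in>E. card {i. i < r \<and> e \<in> \<B> i} \<le> Poly_Mapping.lookup m e)}"
proof -
  let ?P = "\<lambda>r. {m. \<exists>\<B>. (\<forall>i<r. \<B> i \<in> bases M) \<and>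
      (\<forall>e\<in>E. card {i. i < r \<and> e \<in> \<B> i} \<le> Poly_Mapping.lookup m e)}"
  have card_Suc: "card {i. i < Suc s \<and> e \<in> \<B> i} =
    card {i. i < s \<and> e \<in> \<B> i} + (if e \<in> \<B> s then 1 else 0)" for s e and \<B> :: "nat \<Rightarrow> 'a set"
  proof -
    have "{i. i < Suc s \<and> e \<in> \<B> i} = (if e \<in> \<B> s then insert s else id) {i. i < s \<and> e \<in> \<B> i}"
      by (auto simp: less_Suc_eq)
    then show ?thesis by simp
  qed
  have step: "m \<in> ?P (Suc s) \<longleftrightarrow> (\<exists>v w. m = v + w \<and> v \<in> ?P s \<and>
    w \<in> {m. \<exists>B\<in>bases M. \<forall>e\<in>B. 1 \<le> Poly_Mapping.lookup m e})" (is "_ \<longleftrightarrow> ?R")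
    for s and m :: "'a \<Rightarrow>\<^sub>0 nat"
  proof
    assume "m \<in> ?P (Suc s)"
    then obtain \<B> where B: "\<And>i. i < Suc s \<Longrightarrow> \<B> i \<in> bases M"
      "\<And>e. e \<in> E \<Longrightarrow> card {i. i < Suc s \<and> e \<in> \<B> i} \<le> Poly_Mapping.lookup m e" by blast
    have Bs: "finite (\<B> s)" "\<B> s \<subseteq> E" using B(1)[of s] assms finite_subset by blast+
    define w :: "'a \<Rightarrow>\<^sub>0 nat" where "w = (\<Sum>e\<in>\<B> s. Poly_Mapping.single e 1)"
    have w: "Poly_Mapping.lookup w e = (if e \<in> \<B> s then 1 else 0)" for e
      unfolding w_def by (rule lookup_indicator[OF Bs(1)])
    have "m = (m - w) + w"
    proof (rule poly_mapping_eqI)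
      fix e show "Poly_Mapping.lookup m e = Poly_Mapping.lookup (m - w + w) e"
        using B(2)[of e] Bs(2) w[of e] unfolding card_Suc by (auto simp: lookup_add lookup_minus)
    qed
    moreover have "card {i. i < s \<and> e \<in> \<B> i} \<le> Poly_Mapping.lookup (m - w) e" if "e \<in> E" for e
      using B(2)[OF that] w[of e] unfolding card_Suc lookup_minus by (cases "e \<in> \<B> s") simp_all
    then have "m - w \<in> ?P s" using B(1) less_SucI by blast
    moreover have "w \<in> {m. \<exists>B\<in>bases M. \<forall>e\<in>B. 1 \<le> Poly_Mapping.lookup m e}"
      using B(1)[of s] w by auto
    ultimately show ?R by blast
  next
    assume ?R
    then obtain v w \<B> B where vw: "m = v + w" and \<B>: "\<And>i. i < s \<Longrightarrow> \<B> i \<in> bases M"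
      "\<And>e. e \<in> E \<Longrightarrow> card {i. i < s \<and> e \<in> \<B> i} \<le> Poly_Mapping.lookup v e"
      and B: "B \<in> bases M" "\<And>e. e \<in> B \<Longrightarrow> 1 \<le> Poly_Mapping.lookup w e" by blast
    have "{i. i < s \<and> e \<in> (\<B>(s := B)) i} = {i. i < s \<and> e \<in> \<B> i}" for e by auto
    then have "card {i. i < Suc s \<and> e \<in> (\<B>(s := B)) i} \<le> Poly_Mapping.lookup m e" if "e \<in> E" for e
      using \<B>(2)[OF that] B(2)[of e] unfolding card_Suc vw
      by (cases "e \<in> B") (simp_all add: lookup_add)
    then show "m \<in> ?P (Suc s)"
      using \<B>(1) B(1) by (auto intro!: exI[of _ "\<B>(s := B)"] simp: less_Suc_eq simp del: fun_upd_apply) auto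
  qed
  show ?thesis
    unfolding facet_ideal_eq[OF assms]
    by (rule ideal_power_monomial_ideal[where P = ?P, OF _ step]) simp
qed

subsection \<open>Symbolic powers and the initial degree\<close>

lemma primeideal_sqfree_monom:
  assumes "primeideal Q (mpoly_ring K E)" "finite B" "B \<subseteq> E" "sqfree_monom B \<in> Q"
  obtains e where "e \<in> B" "var e \<in> Q"
proof -
  interpret primeideal Q "mpoly_ring K E" by fact
  have carr: "sqfree_monom A \<in> carrier (mpoly_ring K E)" if "finite A" "A \<subseteq> E" for A
    using that by (auto simp: sqfree_monom_eq monomial_ideal_UNIV single_in_monomial_ideal_iff
        in_keys_iff lookup_indicator simp del: One_nat_def split: if_splits)
  have "\<exists>e\<in>B. var e \<in> Q"
    using assms(2-4)
  proof (induction B)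
    case empty
    then have "\<one>\<^bsub>mpoly_ring K E\<^esub> \<in> Q" by (simp add: mpoly_ring_simps sqfree_monom_def)
    then show ?case using one_imp_carrier I_notcarr by simp
  next
    case (insert e B)
    have "var e \<otimes>\<^bsub>mpoly_ring K E\<^esub> sqfree_monom B \<in> Q"
      using insert by (simp add: mpoly_ring_simps sqfree_monom_def)
    moreover have "var e \<in> carrier (mpoly_ring K E)"
      using insert.prems carr[of "{e}"] by (simp add: sqfree_monom_def)
    ultimately have "var e \<in> Q \<or> sqfree_monom B \<in> Q"
      using I_prime carr insert by simp
    then show ?case using insert by auto
  qed
  then show ?thesis using that by blast
qed

definition transversals :: "'e set \<Rightarrow> 'e set set \<Rightarrow> 'e set set" where
  "transversals E \<B> = {C. C \<subseteq> E \<and> (\<forall>B\<in>\<B>. C \<inter> B \<noteq> {})}"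

lemma facet_ideal_subset_coord_ideal:
  assumes "finite E" "bases M \<subseteq> Pow E" "C \<in> transversals E (bases M)"
  shows "facet_ideal (mpoly_ring K E) M \<subseteq> coord_ideal E C"
proof -
  have "1 \<le> exp_sum C m" if "B \<in> bases M" "\<forall>e\<in>B. 1 \<le> Poly_Mapping.lookup m e" for B m
  proof -
    have "C \<inter> B \<noteq> {}" "C \<subseteq> E" using assms(3) that(1) unfolding transversals_def by auto
    then obtain e where e: "e \<in> C" "e \<in> B" by blast
    have "1 \<le> Poly_Mapping.lookup m e" using that(2) e(2) by (rule bspec)
    also have "\<dots> \<le> exp_sum C m"
      unfolding exp_sum_def using finite_subset[OF \<open>C \<subseteq> E\<close> assms(1)] e(1)
      by (intro member_le_sum) simp_all
    finally show ?thesis .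
  qed
  then show ?thesis unfolding facet_ideal_eq[OF assms(1,2)] coord_ideal_def monomial_ideal_def by blast
qed

text \<open>Primality puts a variable of every generator into \<open>Q\<close>. So every prime above
  the facet ideal contains the coordinate prime of a transversal, and the minimal ones are of that
  form.\<close>

lemma prime_contains_transversal:
  assumes "finite E" "bases M \<subseteq> Pow E" "primeideal Q (mpoly_ring K E)"
    "facet_ideal (mpoly_ring K E) M \<subseteq> Q"
  shows "{e \<in> E. var e \<in> Q} \<in> transversals E (bases M)" "coord_ideal E {e \<in> E. var e \<in> Q} \<subseteq> Q"
proof -
  interpret primeideal Q "mpoly_ring K E" by fact
  have "{e \<in> E. var e \<in> Q} \<inter> B \<noteq> {}" if B: "B \<in> bases M" for B
  proof -
    have B': "finite B" "B \<subseteq> E" using B assms finite_subset by blast+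
    have "sqfree_monom B \<in> facet_ideal (mpoly_ring K E) M"
      unfolding facet_ideal_eq[OF assms(1,2)] sqfree_monom_eq[OF B'(1)] single_in_monomial_ideal_iff
      using B B' lookup_indicator[OF B'(1)]
      by (auto simp: in_keys_iff intro!: bexI[of _ B] split: if_splits)
    then show ?thesis using primeideal_sqfree_monom[OF assms(3) B'] assms(4) B'(2) by blast
  qed
  then show "{e \<in> E. var e \<in> Q} \<in> transversals E (bases M)" unfolding transversals_def by blast
  show "coord_ideal E {e \<in> E. var e \<in> Q} \<subseteq> Q"
    using assms(1) by (intro coord_ideal_subset[OF is_ideal]) auto
qed

text \<open>Minimal primes come from the inclusion-minimal transversals, but the condition passes to
  all transversals since \<open>exp_sum\<close> grows with the set. Quantifying over all of them
  permits the description by rank.\<close>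

lemma symbolic_power_facet_ideal:
  assumes "finite E" "bases M \<subseteq> Pow E"
  shows "symbolic_power (mpoly_ring K E) (facet_ideal (mpoly_ring K E) M) s =
    monomial_ideal E {m. \<forall>C\<in>transversals E (bases M). s \<le> exp_sum C m}" (is "?S = ?T")
proof
  let ?R = "mpoly_ring K E" and ?I = "facet_ideal (mpoly_ring K E) M"
  have fin: "finite C" "C \<subseteq> E" if "C \<in> transversals E (bases M)" for C
    using that assms(1) finite_subset unfolding transversals_def by blast+
  show "?S \<subseteq> ?T"
  proof
    fix f assume f: "f \<in> ?S"
    have "s \<le> exp_sum C m" if m: "m \<in> Poly_Mapping.keys f" and C: "C \<in> transversals E (bases M)" for m C
    proof -
      have "finite {D \<in> transversals E (bases M). D \<subseteq> C}" using fin(1)[OF C] by auto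
      then obtain D where D: "D \<in> transversals E (bases M)" "D \<subseteq> C"
        and min: "\<forall>D'\<in>{D \<in> transversals E (bases M). D \<subseteq> C}. D' \<subseteq> D \<longrightarrow> D = D'"
        using finite_has_minimal2[of "{D \<in> transversals E (bases M). D \<subseteq> C}" C] C by auto
      have "coord_ideal E D \<in> minimal_primes ?R ?I"
        unfolding minimal_primes_def mem_Collect_eq
      proof (intro conjI allI impI primeideal_coord_ideal fin(2)[OF D(1)] assms(1)
          facet_ideal_subset_coord_ideal assms D)
        fix Q assume Q: "primeideal Q ?R \<and> ?I \<subseteq> Q \<and> Q \<subseteq> coord_ideal E D"
        then have *: "{e \<in> E. var e \<in> Q} \<in> transversals E (bases M)"
          "coord_ideal E {e \<in> E. var e \<in> Q} \<subseteq> Q"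
          using prime_contains_transversal[OF assms] by blast+
        \<comment> \<open>The variables in \<open>Q\<close> form a transversal inside
          \<open>D\<close>; minimality of \<open>D\<close> makes the two equal, which squeezes
          \<open>Q\<close> onto the coordinate prime.\<close>
        have "{e \<in> E. var e \<in> Q} \<subseteq> D"
        proof clarify
          fix e assume "var e \<in> Q"
          then have "exp_sum D (Poly_Mapping.single e 1) \<noteq> 0"
            using Q unfolding coord_ideal_def by (auto simp: subset_iff var_in_monomial_ideal_iff)
          then show "e \<in> D" using fin(1)[OF D(1)] unfolding exp_sum_def
            by (auto simp: lookup_single when_def split: if_splits)
        qed
        then have "{e \<in> E. var e \<in> Q} = D" using min * D(2) by blast
        then show "Q = coord_ideal E D" using * Q by auto
      qed
      then have "f \<in> ideal_power ?R (coord_ideal E D) s"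
        using f unfolding symbolic_power_def by blast
      then have "s \<le> exp_sum D m"
        using m unfolding ideal_power_coord_ideal[OF fin(1)[OF D(1)]] monomial_ideal_def by blast
      also have "\<dots> \<le> exp_sum C m" using exp_sum_mono[OF fin(1)[OF C] D(2)] .
      finally show ?thesis .
    qed
    then show "f \<in> ?T" using f unfolding symbolic_power_def monomial_ideal_UNIV monomial_ideal_def by blast
  qed
  show "?T \<subseteq> ?S"
  proof
    fix f :: "('a, 'b) mpoly" assume f: "f \<in> ?T"
    have "f \<in> ideal_power ?R Q s" if Q: "Q \<in> minimal_primes ?R ?I" for Q
    proof -
      define D where "D = {e \<in> E. var e \<in> Q}"
      have D: "D \<in> transversals E (bases M)" "coord_ideal E D \<subseteq> Q"
        using Q prime_contains_transversal[OF assms, of Q] unfolding minimal_primes_def D_def by blast+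
      have "primeideal (coord_ideal E D) ?R" "?I \<subseteq> coord_ideal E D"
        using primeideal_coord_ideal[OF assms(1) fin(2)[OF D(1)]]
          facet_ideal_subset_coord_ideal[OF assms D(1)] by blast+
      then have "Q = coord_ideal E D" using Q D(2) unfolding minimal_primes_def by blast
      then show ?thesis
        using f D(1) unfolding monomial_ideal_def
        by (auto simp: ideal_power_coord_ideal[OF fin(1)[OF D(1)]] monomial_ideal_def)
    qed
    then show "f \<in> ?S"
      using f monomial_ideal_carrier[of E _ K] unfolding symbolic_power_def by blast
  qed
qed

lemma initial_degree_monomial_ideal:
  assumes "finite E"
  shows "initial_degree (monomial_ideal E W :: ('e, 'k::field) mpoly set) =
    (LEAST d. \<exists>m\<in>W. Poly_Mapping.keys m \<subseteq> E \<and> exp_sum E m = d)"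
proof -
  have deg: "(\<Sum>e\<in>Poly_Mapping.keys m. Poly_Mapping.lookup m e) = exp_sum E m"
    if "Poly_Mapping.keys m \<subseteq> E" for m
    unfolding exp_sum_def using assms that by (intro sum.mono_neutral_left) (auto simp: in_keys_iff)
  have "(\<exists>f\<in>(monomial_ideal E W :: ('e, 'k) mpoly set). f \<noteq> 0 \<and> homogeneous d f) \<longleftrightarrow>
    (\<exists>m\<in>W. Poly_Mapping.keys m \<subseteq> E \<and> exp_sum E m = d)" for d
  proof
    assume "\<exists>f\<in>(monomial_ideal E W :: ('e, 'k) mpoly set). f \<noteq> 0 \<and> homogeneous d f"
    then obtain f :: "('e, 'k) mpoly" where f: "f \<in> monomial_ideal E W" "f \<noteq> 0" "homogeneous d f"
      by blast
    then obtain m where "m \<in> Poly_Mapping.keys f" using keys_eq_empty by blast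
    then show "\<exists>m\<in>W. Poly_Mapping.keys m \<subseteq> E \<and> exp_sum E m = d"
      using f deg[of m] unfolding monomial_ideal_def homogeneous_def by force
  next
    assume "\<exists>m\<in>W. Poly_Mapping.keys m \<subseteq> E \<and> exp_sum E m = d"
    then obtain m where m: "m \<in> W" "Poly_Mapping.keys m \<subseteq> E" "exp_sum E m = d" by blast
    then have "homogeneous d (Poly_Mapping.single m (1::'k))"
      unfolding homogeneous_def using deg by simp
    moreover have "Poly_Mapping.single m (1::'k) \<noteq> 0" by (metis lookup_single_eq lookup_zero zero_neq_one)
    ultimately show "\<exists>f\<in>(monomial_ideal E W :: ('e, 'k) mpoly set). f \<noteq> 0 \<and> homogeneous d f"
      using m by (intro bexI[of _ "Poly_Mapping.single m 1"]) (auto simp: single_in_monomial_ideal_iff)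
  qed
  then show ?thesis unfolding initial_degree_def by simp
qed

section \<open>Waldschmidt constants\<close>

text \<open>Fekete's lemma, with the limit identified as the infimum of the quotients. Division with
  remainder by a nearly optimal \<open>q\<close> bounds \<open>a n\<close> up to one of finitely
  many remainder terms.\<close>

lemma subadditive_quotient_limit:
  fixes a :: "nat \<Rightarrow> real"
  assumes nonneg: "\<And>n. 0 \<le> a n" and subadd: "\<And>m n. a (m + n) \<le> a m + a n"
  obtains L where "(\<lambda>n. a n / real n) \<longlonglongrightarrow> L" "\<And>n. 0 < n \<Longrightarrow> L \<le> a n / real n"
proof -
  define X where "X = (\<lambda>n. a n / real n) ` {0<..}"
  define L where "L = Inf X"
  have bdd: "bdd_below X" unfolding X_def by (rule bdd_belowI[of _ 0]) (auto simp: nonneg)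
  have X_ne: "X \<noteq> {}" unfolding X_def by auto
  have L_le: "L \<le> a n / real n" if "0 < n" for n
    unfolding L_def by (rule cInf_lower[OF _ bdd]) (use that in \<open>auto simp: X_def\<close>)
  have mult: "a (j * q + r) \<le> real j * a q + a r" for j q r
  proof (induction j)
    case (Suc j)
    have "a (Suc j * q + r) \<le> a q + a (j * q + r)" using subadd[of q "j * q + r"] by (simp add: add.assoc)
    then show ?case using Suc by (simp add: algebra_simps)
  qed simp
  have "(\<lambda>n. a n / real n) \<longlonglongrightarrow> L"
  proof (rule LIMSEQ_I)
    fix \<epsilon> :: real assume "0 < \<epsilon>"
    then have "Inf X < L + \<epsilon> / 2" unfolding L_def by simp
    then obtain x where "x \<in> X" "x < L + \<epsilon> / 2" using cInf_lessD[OF X_ne] by blast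
    then obtain q where q: "0 < q" "a q / real q < L + \<epsilon> / 2" unfolding X_def by auto
    define c where "c = (\<Sum>r<q. a r)"
    have c: "a r \<le> c" if "r < q" for r
      unfolding c_def using that by (intro member_le_sum) (auto simp: nonneg)
    obtain N where N: "2 * c / \<epsilon> < real N" using reals_Archimedean2 by blast
    show "\<exists>N. \<forall>n\<ge>N. norm (a n / real n - L) < \<epsilon>"
    proof (intro exI allI impI)
      \<comment> \<open>The successor ensures that \<open>n\<close> is positive even if
        \<open>N\<close> is 0.\<close>
      fix n assume n: "Suc N \<le> n"
      then have n0: "0 < real n" by simp
      have "a n \<le> real (n div q) * a q + a (n mod q)" using mult[of "n div q" q "n mod q"] by simp
      also have "\<dots> \<le> real n / real q * a q + c"
      proof (intro add_mono mult_right_mono nonneg c)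
        show "real (n div q) \<le> real n / real q" by (rule of_nat_div_le_of_nat)
        show "n mod q < q" using q(1) by simp
      qed
      finally have "a n / real n \<le> (real n / real q * a q + c) / real n"
        using n0 by (intro divide_right_mono) auto
      also have "\<dots> = a q / real q + c / real n" using n0 by (simp add: add_divide_distrib)
      also have "c / real n < \<epsilon> / 2"
      proof -
        have "2 * c / \<epsilon> < real n" using N n by linarith
        then show ?thesis using \<open>0 < \<epsilon>\<close> n0 by (simp add: field_simps)
      qed
      finally have "a n / real n < L + \<epsilon>" using q(2) by simp
      then show "norm (a n / real n - L) < \<epsilon>" using L_le[of n] n by simp
    qed
  qed
  then show ?thesis using that L_le by blast
qed

text \<open>The initial degree stripped of the coefficient field: the optimum of an integer covering
  problem for the family \<open>T\<close>.\<close>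

definition min_degree :: "'e set \<Rightarrow> 'e set set \<Rightarrow> nat \<Rightarrow> nat" where
  "min_degree E T s = (LEAST d. \<exists>m. (\<forall>C\<in>T. s \<le> exp_sum C m) \<and>
    Poly_Mapping.keys m \<subseteq> E \<and> exp_sum E m = d)"

lemma initial_degree_symbolic_power:
  assumes "finite E" "bases M \<subseteq> Pow E"
  shows "initial_degree (symbolic_power (mpoly_ring K E) (facet_ideal (mpoly_ring K E) M) s) =
    min_degree E (transversals E (bases M)) s"
  unfolding symbolic_power_facet_ideal[OF assms] initial_degree_monomial_ideal[OF assms(1)]
    min_degree_def by simp

lemma waldschmidt_constant_eq:
  assumes "finite E" "bases M \<subseteq> Pow E"
  shows "waldschmidt_constant (mpoly_ring K E) (facet_ideal (mpoly_ring K E) M) =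
    lim (\<lambda>s. real (min_degree E (transversals E (bases M)) s) / real s)"
  unfolding waldschmidt_constant_def initial_degree_symbolic_power[OF assms] ..

lemma min_degree_le:
  assumes "\<And>C. C \<in> T \<Longrightarrow> s \<le> exp_sum C m" "Poly_Mapping.keys m \<subseteq> E"
  shows "min_degree E T s \<le> exp_sum E m"
  unfolding min_degree_def using assms by (intro Least_le) blast

lemma exponent_of_fun:
  fixes g :: "'e \<Rightarrow> nat"
  assumes "finite E"
  obtains m where "\<And>e. Poly_Mapping.lookup m e = (if e \<in> E then g e else 0)"
    "Poly_Mapping.keys m \<subseteq> E"
proof
  let ?m = "Abs_poly_mapping (\<lambda>e. if e \<in> E then g e else 0)"
  have "finite {e. (if e \<in> E then g e else 0) \<noteq> 0}" by (rule finite_subset[OF _ assms]) auto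
  then show lookup: "Poly_Mapping.lookup ?m e = (if e \<in> E then g e else 0)" for e by simp
  show "Poly_Mapping.keys ?m \<subseteq> E" using lookup by (auto simp: in_keys_iff split: if_splits)
qed

lemma le_exp_sum: "finite C \<Longrightarrow> e \<in> C \<Longrightarrow> Poly_Mapping.lookup m e \<le> exp_sum C m"
  unfolding exp_sum_def by (rule member_le_sum) auto

lemma min_degree_attained:
  assumes "finite E" "T \<subseteq> Pow E" "{} \<notin> T"
  obtains m where "\<And>C. C \<in> T \<Longrightarrow> s \<le> exp_sum C m" "Poly_Mapping.keys m \<subseteq> E"
    "exp_sum E m = min_degree E T s"
proof -
  \<comment> \<open>The constant exponent \<open>s\<close> is feasible since every member of
    \<open>T\<close> is nonempty; hence the least degree is attained.\<close>
  obtain m0 where m0: "\<And>e. Poly_Mapping.lookup m0 e = (if e \<in> E then s else 0)"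
    "Poly_Mapping.keys m0 \<subseteq> E"
    by (rule exponent_of_fun[OF assms(1), of "\<lambda>_. s"]) blast
  have "s \<le> exp_sum C m0" if C: "C \<in> T" for C
  proof -
    obtain e where "e \<in> C" using assms(3) C by (metis ex_in_conv)
    moreover have "C \<subseteq> E" using assms(2) C by blast
    ultimately show ?thesis
      using le_exp_sum[OF finite_subset[OF _ assms(1)], of C e m0] m0(1)[of e] by auto
  qed
  then have "\<exists>d m. (\<forall>C\<in>T. s \<le> exp_sum C m) \<and> Poly_Mapping.keys m \<subseteq> E \<and> exp_sum E m = d"
    using m0(2) by blast
  from LeastI_ex[OF this] show ?thesis using that unfolding min_degree_def by blast
qed

text \<open>Adding optimal exponents for \<open>s\<close> and \<open>t\<close> gives a feasible one
  for \<open>s + t\<close>, hence subadditivity. A single member of \<open>T\<close> already forces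
  degree \<open>s\<close>; the resulting bound \<open>1 \<le> L\<close> keeps the denominators of
  the ratios positive.\<close>

lemma min_degree_limit:
  assumes "finite E" "T \<subseteq> Pow E" "{} \<notin> T" "T \<noteq> {}"
  obtains L where "(\<lambda>s. real (min_degree E T s) / real s) \<longlonglongrightarrow> L"
    "\<And>s. 0 < s \<Longrightarrow> L \<le> real (min_degree E T s) / real s" "1 \<le> L"
proof -
  let ?a = "\<lambda>s. real (min_degree E T s)"
  have "?a (s + t) \<le> ?a s + ?a t" for s t
  proof -
    obtain m where m: "\<And>C. C \<in> T \<Longrightarrow> s \<le> exp_sum C m" "Poly_Mapping.keys m \<subseteq> E"
      "exp_sum E m = min_degree E T s"
      by (rule min_degree_attained[OF assms(1-3), where s = s]) blast
    obtain n where n: "\<And>C. C \<in> T \<Longrightarrow> t \<le> exp_sum C n" "Poly_Mapping.keys n \<subseteq> E"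
      "exp_sum E n = min_degree E T t"
      by (rule min_degree_attained[OF assms(1-3), where s = t]) blast
    have "min_degree E T (s + t) \<le> exp_sum E (m + n)"
      by (rule min_degree_le) (use m n in \<open>auto simp: exp_sum_add keys_add_nat add_mono\<close>)
    then show ?thesis using m n by (simp add: exp_sum_add)
  qed
  then obtain L where L: "(\<lambda>s. ?a s / real s) \<longlonglongrightarrow> L" "\<And>s. 0 < s \<Longrightarrow> L \<le> ?a s / real s"
    by (rule subadditive_quotient_limit[of ?a, rotated]) auto
  have "1 \<le> ?a s / real s" if "0 < s" for s
  proof -
    obtain m where m: "\<And>C. C \<in> T \<Longrightarrow> s \<le> exp_sum C m" "exp_sum E m = min_degree E T s"
      by (rule min_degree_attained[OF assms(1-3), where s = s]) blast
    obtain C where C: "C \<in> T" "C \<subseteq> E" using assms(2,4) by blast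
    have "s \<le> min_degree E T s"
      using m(1)[OF C(1)] exp_sum_mono[OF assms(1) C(2), of m] m(2) by simp
    then show ?thesis using that by simp
  qed
  then have "1 \<le> L" using L(1) by (intro LIMSEQ_le_const[OF L(1)] exI[of _ 1]) auto
  with L show ?thesis using that by blast
qed

section \<open>Transversals of contractions and the containment criterion\<close>

context matroid
begin

lemma contraction_bases: "bases (contraction M U) \<subseteq> Pow (ground M)"
  unfolding contraction_def by auto

lemma transversals_bases:
  "C \<in> transversals (ground M) (bases M) \<longleftrightarrow>
    C \<subseteq> ground M \<and> rk M (ground M - C) < rk M (ground M)"
proof -
  have "(\<forall>B\<in>bases M. C \<inter> B \<noteq> {}) \<longleftrightarrow> \<not> (\<exists>B\<in>bases M. B \<subseteq> ground M - C)"
    using bases_subset by blast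
  then show ?thesis
    unfolding transversals_def using rk_full_iff[of "ground M - C"] rk_le[of "ground M - C"] by auto
qed

lemma transversals_contraction:
  assumes "U \<subseteq> ground M"
  shows "C \<in> transversals (ground M) (bases (contraction M U)) \<longleftrightarrow>
    C \<subseteq> ground M \<and> rk M ((ground M - C) \<union> U) < rk M (ground M)"
  unfolding transversals_def using contraction_transversal_iff[OF assms] by auto

lemma transversals_contraction_cong:
  assumes "W \<subseteq> V" "V \<subseteq> ground M" "rk M W = rk M V"
  shows "transversals (ground M) (bases (contraction M W)) =
    transversals (ground M) (bases (contraction M V))"
proof -
  have "rk M ((ground M - C) \<union> W) = rk M ((ground M - C) \<union> V)" for C
  proof -
    have "(ground M - C) \<union> W \<union> V = (ground M - C) \<union> V" using assms(1) by auto
    then show ?thesis using rk_Un_eq[OF assms(1,3), of "(ground M - C) \<union> W"] by simp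
  qed
  then show ?thesis
    using assms by (auto simp: transversals_contraction)
qed

lemma transversals_contraction_nontrivial:
  assumes "U \<subseteq> ground M" "rk M U < rk M (ground M)"
  shows "transversals (ground M) (bases (contraction M U)) \<subseteq> Pow (ground M)"
    "{} \<notin> transversals (ground M) (bases (contraction M U))"
    "transversals (ground M) (bases (contraction M U)) \<noteq> {}"
proof -
  show "transversals (ground M) (bases (contraction M U)) \<subseteq> Pow (ground M)"
    unfolding transversals_def by auto
  show "{} \<notin> transversals (ground M) (bases (contraction M U))"
    using assms by (simp add: transversals_contraction Un_absorb2)
  have "ground M \<in> transversals (ground M) (bases (contraction M U))"
    using assms by (simp add: transversals_contraction)
  then show "transversals (ground M) (bases (contraction M U)) \<noteq> {}" by blast
qed

text \<open>Necessity is double counting: each of the \<open>r\<close> bases has at least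
  \<open>rk M (ground M) - rk M U\<close> elements outside \<open>U\<close>. Sufficiency is
  \<open>basis_packing\<close>.\<close>

lemma facet_ideal_power_eq:
  "ideal_power (mpoly_ring K (ground M)) (facet_ideal (mpoly_ring K (ground M)) M) r =
    monomial_ideal (ground M) {m. \<forall>U\<subseteq>ground M.
      r * (rk M (ground M) - rk M U) \<le> exp_sum (ground M - U) m}"
proof -
  have sub: "bases M \<subseteq> Pow (ground M)" using bases_subset by blast
  have "(\<exists>\<B>. (\<forall>i<r. \<B> i \<in> bases M) \<and>
      (\<forall>e\<in>ground M. card {i. i < r \<and> e \<in> \<B> i} \<le> Poly_Mapping.lookup m e)) \<longleftrightarrow>
    (\<forall>U\<subseteq>ground M. r * (rk M (ground M) - rk M U) \<le> exp_sum (ground M - U) m)"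
    (is "?L \<longleftrightarrow> ?R") for m
  proof
    assume ?L
    then obtain \<B> where B: "\<And>i. i < r \<Longrightarrow> \<B> i \<in> bases M"
      "\<And>e. e \<in> ground M \<Longrightarrow> card {i. i < r \<and> e \<in> \<B> i} \<le> Poly_Mapping.lookup m e" by blast
    show ?R
    proof (intro allI impI)
      fix U assume "U \<subseteq> ground M"
      have "rk M (ground M) - rk M U \<le> card (\<B> i - U)" if "i < r" for i
        using card_Int_Diff[OF finite_basis[OF B(1)[OF that]], of U]
          card_Int_le_rk[OF B(1)[OF that], of U] card_basis[OF B(1)[OF that]]
        by (simp add: Int_commute)
      then have le: "r * (rk M (ground M) - rk M U) \<le> (\<Sum>i<r. card (\<B> i - U))"
        using sum_bounded_below[of "{..<r}" "rk M (ground M) - rk M U" "\<lambda>i. card (\<B> i - U)"] by simp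
      also have "\<dots> = (\<Sum>i<r. \<Sum>e\<in>ground M - U. if e \<in> \<B> i then 1 else 0)"
      proof (rule sum.cong[OF refl])
        fix i assume "i \<in> {..<r}"
        then have "(ground M - U) \<inter> \<B> i = \<B> i - U" using B(1)[of i] bases_subset by auto
        then show "card (\<B> i - U) = (\<Sum>e\<in>ground M - U. if e \<in> \<B> i then 1 else 0)"
          using finite_ground by (simp add: sum.If_cases Int_def)
      qed
      also have "\<dots> = (\<Sum>e\<in>ground M - U. \<Sum>i<r. if e \<in> \<B> i then 1 else 0)"
        by (rule sum.swap)
      also have "\<dots> = (\<Sum>e\<in>ground M - U. card {i. i < r \<and> e \<in> \<B> i})"
        by (simp add: sum.If_cases Int_def lessThan_def)
      also have "\<dots> \<le> exp_sum (ground M - U) m"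
        unfolding exp_sum_def using B(2) by (intro sum_mono) auto
      finally show "r * (rk M (ground M) - rk M U) \<le> exp_sum (ground M - U) m" .
    qed
  next
    assume ?R
    then have le: "r * (rk M (ground M) - rk M U) \<le> (\<Sum>e\<in>ground M - U. Poly_Mapping.lookup m e)"
      if "U \<subseteq> ground M" for U using that unfolding exp_sum_def by blast
    obtain \<B> where "\<And>i. i < r \<Longrightarrow> \<B> i \<in> bases M"
      "\<And>e. e \<in> ground M \<Longrightarrow> card {i. i < r \<and> e \<in> \<B> i} \<le> Poly_Mapping.lookup m e"
      by (rule basis_packing[OF le]) blast+
    then show ?L by blast
  qed
  then show ?thesis unfolding ideal_power_facet_ideal[OF finite_ground sub] by simp
qed

abbreviation contraction_degree :: "'e set \<Rightarrow> nat \<Rightarrow> nat" where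
  "contraction_degree U s \<equiv>
    min_degree (ground M) (transversals (ground M) (bases (contraction M U))) s"

text \<open>
  Minimising the degree on the complement of \<open>U\<close> over the symbolic polyhedron of \<open>M\<close> amounts to
  minimising the degree over that of \<open>M/U\<close>, because exponents on \<open>U\<close> are free.
\<close>

lemma symbolic_power_subset_power_iff:
  "symbolic_power (mpoly_ring K (ground M)) (facet_ideal (mpoly_ring K (ground M)) M) s \<subseteq>
    ideal_power (mpoly_ring K (ground M)) (facet_ideal (mpoly_ring K (ground M)) M) r \<longleftrightarrow>
    (\<forall>U\<subseteq>ground M. rk M U < rk M (ground M) \<longrightarrow>
      r * (rk M (ground M) - rk M U) \<le> contraction_degree U s)"
    (is "?I \<subseteq> ?J \<longleftrightarrow> ?R")
proof -
  let ?E = "ground M" and ?k = "rk M (ground M)"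
  have sub: "bases M \<subseteq> Pow ?E" using bases_subset by blast
  have I: "?I = monomial_ideal ?E {m. \<forall>C\<in>transversals ?E (bases M). s \<le> exp_sum C m}"
    by (rule symbolic_power_facet_ideal[OF finite_ground sub])
  have fin: "finite A" if "A \<subseteq> ?E" for A using that finite_ground finite_subset by blast
  show ?thesis
  proof
    assume L: "?I \<subseteq> ?J"
    show ?R
    proof (intro allI impI)
      fix U assume U: "U \<subseteq> ?E" "rk M U < ?k"
      obtain m where m: "\<And>C. C \<in> transversals ?E (bases (contraction M U)) \<Longrightarrow> s \<le> exp_sum C m"
        "Poly_Mapping.keys m \<subseteq> ?E" "exp_sum ?E m = contraction_degree U s"
        by (rule min_degree_attained[OF finite_ground transversals_contraction_nontrivial(1,2)[OF U],
              where s = s]) blast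
      \<comment> \<open>Weight \<open>s\<close> on each element of \<open>U\<close> satisfies every
        transversal of \<open>M\<close> that meets \<open>U\<close>, at no cost outside
        \<open>U\<close>. The transversals disjoint from \<open>U\<close> are also transversals of
        the contraction, and \<open>m\<close> serves them.\<close>
      obtain u where u: "\<And>e. Poly_Mapping.lookup u e = (if e \<in> U then s else 0)"
        "Poly_Mapping.keys u \<subseteq> U"
        by (rule exponent_of_fun[OF fin[OF U(1)], of "\<lambda>_. s"]) blast
      have "s \<le> exp_sum C (m + u)" if C: "C \<in> transversals ?E (bases M)" for C
      proof (cases "C \<inter> U = {}")
        case True
        have C': "C \<subseteq> ?E" "rk M (?E - C) < ?k" using C transversals_bases by blast+
        have "(?E - C) \<union> U = ?E - C" using True U(1) by blast
        then have "C \<in> transversals ?E (bases (contraction M U))"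
          using C' transversals_contraction[OF U(1)] by simp
        then show ?thesis using m(1) by (simp add: exp_sum_add trans_le_add1)
      next
        case False
        then obtain e where e: "e \<in> C" "e \<in> U" by blast
        have "finite C" using C fin transversals_bases by blast
        then have "s \<le> exp_sum C u" using le_exp_sum[of C e u] e u(1) by simp
        then show ?thesis by (simp add: exp_sum_add)
      qed
      moreover have keys: "Poly_Mapping.keys (m + u) \<subseteq> ?E" using m(2) u(2) U(1) by (simp add: keys_add_nat)
      ultimately have "Poly_Mapping.single (m + u) 1 \<in> ?I"
        unfolding I single_in_monomial_ideal_iff by blast
      then have "Poly_Mapping.single (m + u) 1 \<in> ?J" using L by blast
      then have "r * (?k - rk M U) \<le> exp_sum (?E - U) (m + u)"
        unfolding facet_ideal_power_eq single_in_monomial_ideal_iff using U(1) by auto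
      also have "exp_sum (?E - U) u = 0" unfolding exp_sum_def using u(1) by simp
      then have "exp_sum (?E - U) (m + u) = exp_sum (?E - U) m" by (simp add: exp_sum_add)
      also have "\<dots> \<le> exp_sum ?E m" by (rule exp_sum_mono[OF finite_ground]) auto
      finally show "r * (?k - rk M U) \<le> contraction_degree U s" using m(3) by simp
    qed
  next
    assume R: ?R
    have "r * (?k - rk M U) \<le> exp_sum (?E - U) m"
      if m: "\<And>C. C \<in> transversals ?E (bases M) \<Longrightarrow> s \<le> exp_sum C m" and U: "U \<subseteq> ?E" for m U
    proof (cases "rk M U < ?k")
      case True
      \<comment> \<open>Erasing \<open>m\<close> on \<open>U\<close> keeps it feasible for the
        contraction: if \<open>C\<close> is a transversal there, then \<open>C - U\<close> is a
        transversal of \<open>M\<close>, and \<open>m'\<close> has the same weight on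
        \<open>C\<close> as \<open>m\<close> has on \<open>C - U\<close>.\<close>
      obtain m' where m': "\<And>e. Poly_Mapping.lookup m' e =
          (if e \<in> ?E - U then Poly_Mapping.lookup m e else 0)" "Poly_Mapping.keys m' \<subseteq> ?E - U"
        by (rule exponent_of_fun[of "?E - U" "Poly_Mapping.lookup m"]) (use finite_ground in auto)
      have exp_sum_m': "exp_sum C m' = exp_sum (C - U) m" if "C \<subseteq> ?E" for C
      proof -
        have "exp_sum C m' = exp_sum (C - U) m'"
          unfolding exp_sum_def using fin[OF that] m'(1) by (intro sum.mono_neutral_right) auto
        also have "\<dots> = exp_sum (C - U) m"
          unfolding exp_sum_def using m'(1) that by (intro sum.cong) auto
        finally show ?thesis .
      qed
      have "contraction_degree U s \<le> exp_sum ?E m'"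
      proof (rule min_degree_le)
        fix C assume "C \<in> transversals ?E (bases (contraction M U))"
        then have C: "C \<subseteq> ?E" "rk M ((?E - C) \<union> U) < ?k"
          using transversals_contraction[OF U] by blast+
        have "?E - (C - U) = (?E - C) \<union> U" using U by blast
        then have "C - U \<in> transversals ?E (bases M)" using C transversals_bases by auto
        then show "s \<le> exp_sum C m'" using m exp_sum_m'[OF C(1)] by simp
      qed (use m'(2) in auto)
      then show ?thesis using R U True exp_sum_m'[OF order_refl] by (metis le_trans)
    next
      case False
      then show ?thesis by simp
    qed
    then show "?I \<subseteq> ?J" unfolding I facet_ideal_power_eq monomial_ideal_def by auto
  qed
qed

abbreviation contraction_waldschmidt :: "'k::field itself \<Rightarrow> 'e set \<Rightarrow> real" where
  "contraction_waldschmidt K U \<equiv> waldschmidt_constant (mpoly_ring K (ground M))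
    (facet_ideal (mpoly_ring K (ground M)) (contraction M U))"

lemma contraction_waldschmidt_cong:
  assumes "W \<subseteq> V" "V \<subseteq> ground M" "rk M W = rk M V"
  shows "contraction_waldschmidt K W = contraction_waldschmidt K V"
  unfolding waldschmidt_constant_eq[OF finite_ground contraction_bases]
    transversals_contraction_cong[OF assms] ..

lemma contraction_waldschmidt_limit:
  assumes "U \<subseteq> ground M" "rk M U < rk M (ground M)"
  shows "(\<lambda>s. real (contraction_degree U s) / real s) \<longlonglongrightarrow> contraction_waldschmidt K U"
    "0 < s \<Longrightarrow> contraction_waldschmidt K U * real s \<le> real (contraction_degree U s)"
    "1 \<le> contraction_waldschmidt K U"
proof -
  obtain L where L: "(\<lambda>s. real (contraction_degree U s) / real s) \<longlonglongrightarrow> L"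
    "\<And>s. 0 < s \<Longrightarrow> L \<le> real (contraction_degree U s) / real s" "1 \<le> L"
    using min_degree_limit[OF finite_ground transversals_contraction_nontrivial[OF assms]] by blast
  have "contraction_waldschmidt K U = L"
    unfolding waldschmidt_constant_eq[OF finite_ground contraction_bases] by (rule limI[OF L(1)])
  then show "(\<lambda>s. real (contraction_degree U s) / real s) \<longlonglongrightarrow> contraction_waldschmidt K U"
    "0 < s \<Longrightarrow> contraction_waldschmidt K U * real s \<le> real (contraction_degree U s)"
    "1 \<le> contraction_waldschmidt K U"
    using L(1) L(2)[of s] L(3) by (simp_all add: pos_le_divide_eq)
qed

section \<open>Asymptotic resurgence\<close>

lemma asymptotic_resurgence_eq_Max:
  fixes K :: "'k::field itself"
  assumes "1 \<le> rk M (ground M)"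
  shows "asymptotic_resurgence (mpoly_ring K (ground M)) (facet_ideal (mpoly_ring K (ground M)) M) =
    ereal (MAX U \<in> {U. U \<subseteq> ground M \<and> rk M U < rk M (ground M)}.
      (real (rk M (ground M)) - real (rk M U)) / contraction_waldschmidt K U)"
proof -
  let ?E = "ground M" and ?k = "rk M (ground M)"
  let ?I = "facet_ideal (mpoly_ring K ?E) M"
  let ?w = "contraction_waldschmidt K"
  define \<A> where "\<A> = {U. U \<subseteq> ?E \<and> rk M U < ?k}"
  define ratio where "ratio U = (real ?k - real (rk M U)) / ?w U" for U
  define \<rho> where "\<rho> = Max (ratio ` \<A>)"
  define X where "X = {ereal (real s / real r) | s r :: nat. 0 < s \<and> 0 < r \<and>
    (\<forall>\<^sub>F t in sequentially. \<not> symbolic_power (mpoly_ring K ?E) ?I (s * t) \<subseteq>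
      ideal_power (mpoly_ring K ?E) ?I (r * t))}"
  have fin: "finite (ratio ` \<A>)"
    by (intro finite_imageI finite_subset[of \<A> "Pow ?E"]) (use finite_ground in \<open>auto simp: \<A>_def\<close>)
  have "{} \<in> \<A>" unfolding \<A>_def using assms by simp
  then have ne: "ratio ` \<A> \<noteq> {}" by blast
  have w_pos: "0 < ?w U" if "U \<in> \<A>" for U
    using contraction_waldschmidt_limit(3)[where K = K and U = U] that unfolding \<A>_def by fastforce
  have subset_iff: "symbolic_power (mpoly_ring K ?E) ?I s \<subseteq> ideal_power (mpoly_ring K ?E) ?I r \<longleftrightarrow>
    (\<forall>U\<in>\<A>. r * (?k - rk M U) \<le> contraction_degree U s)" for s r
    unfolding symbolic_power_subset_power_iff \<A>_def by auto
  have "0 < ratio {}" unfolding ratio_def using assms w_pos[OF \<open>{} \<in> \<A>\<close>] by simp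
  also have "ratio {} \<le> \<rho>" unfolding \<rho>_def using fin \<open>{} \<in> \<A>\<close> by simp
  finally have "0 < \<rho>" .
  have upper: "x \<le> ereal \<rho>" if x_in: "x \<in> X" for x
  proof -
    obtain s r where x: "x = ereal (real s / real r)" "0 < s" "0 < r" and
      ev: "\<forall>\<^sub>F t in sequentially. \<not> symbolic_power (mpoly_ring K ?E) ?I (s * t) \<subseteq>
        ideal_power (mpoly_ring K ?E) ?I (r * t)"
      using x_in unfolding X_def by blast
    have "real s / real r \<le> \<rho>"
    proof (rule ccontr)
      assume "\<not> real s / real r \<le> \<rho>"
      then have gt: "\<rho> < real s / real r" by simp
      \<comment> \<open>A single positive \<open>t\<close> is enough, because the Waldschmidt
        constant bounds the degree at every positive exponent and not just asymptotically.\<close>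
      obtain t where t: "0 < t" "\<not> symbolic_power (mpoly_ring K ?E) ?I (s * t) \<subseteq>
        ideal_power (mpoly_ring K ?E) ?I (r * t)"
        using eventually_happens'[OF _ eventually_conj[OF eventually_gt_at_top[of 0] ev]] by auto
      have "r * t * (?k - rk M U) \<le> contraction_degree U (s * t)" if U: "U \<in> \<A>" for U
      proof -
        have "ratio U < real s / real r"
          using Max_ge[OF fin, of "ratio U"] U gt unfolding \<rho>_def by fastforce
        then have "(real ?k - real (rk M U)) * real r < real s * ?w U"
          unfolding ratio_def using w_pos[OF U] x by (simp add: field_simps)
        then have "real t * ((real ?k - real (rk M U)) * real r) \<le> real t * (real s * ?w U)"
          by (intro mult_left_mono) auto
        also have "\<dots> \<le> real (contraction_degree U (s * t))"
          using contraction_waldschmidt_limit(2)[where K = K and U = U and s = "s * t"] U t x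
          unfolding \<A>_def by (simp add: mult_ac)
        finally have "real (r * t * (?k - rk M U)) \<le> real (contraction_degree U (s * t))"
          using U unfolding \<A>_def by (simp add: of_nat_diff mult_ac)
        then show ?thesis by (simp only: of_nat_le_iff)
      qed
      then show False using t subset_iff by blast
    qed
    then show ?thesis using x by simp
  qed
  have lower: "\<exists>x\<in>X. ereal y < x" if y_less: "y < \<rho>" for y
  proof -
    \<comment> \<open>The lower bound \<open>max y 0\<close> makes \<open>q\<close> positive, so
      that it is a quotient of two positive natural numbers.\<close>
    obtain q where q: "max y 0 < of_rat q" "of_rat q < \<rho>"
      using of_rat_dense[of "max y 0" \<rho>] y_less \<open>0 < \<rho>\<close> by auto
    then have "0 < q" by (metis max_less_iff_conj zero_less_of_rat_iff)
    then obtain s r :: nat where sr: "real_of_rat q = real s / real r" "0 < s" "0 < r"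
    proof -
      obtain a b where ab: "q = Rat.Fract a b" "0 < b" by (cases q)
      then have "0 < a" using \<open>0 < q\<close> by (simp add: zero_less_Fract_iff)
      then show ?thesis using that[of "nat a" "nat b"] ab by (simp add: of_rat_rat)
    qed
    \<comment> \<open>The inequality for one maximising \<open>U\<close> is to fail for all large
      \<open>t\<close>, which destroys the containment.\<close>
    obtain U where U: "U \<in> \<A>" "\<rho> = ratio U" using Max_in[OF fin ne] unfolding \<rho>_def by blast
    have "real s / real r * ?w U < real ?k - real (rk M U)"
      using q(2) w_pos[OF U(1)] unfolding sr U(2) ratio_def by (simp add: field_simps)
    then have less: "?w U < real r * (real ?k - real (rk M U)) / real s"
      using sr by (simp add: field_simps)
    \<comment> \<open>The degrees occur at the multiples \<open>s * t\<close> only, so the limit is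
      taken along this subsequence.\<close>
    have "filterlim (\<lambda>t. s * t) sequentially sequentially"
      using sr(2) by (intro filterlim_subseq strict_monoI) simp
    moreover have "(\<lambda>s. real (contraction_degree U s) / real s) \<longlonglongrightarrow> ?w U"
      using U(1) unfolding \<A>_def by (intro contraction_waldschmidt_limit(1)) auto
    ultimately have "(\<lambda>t. real (contraction_degree U (s * t)) / real (s * t)) \<longlonglongrightarrow> ?w U"
      by (rule filterlim_compose[rotated])
    then have "\<forall>\<^sub>F t in sequentially. real (contraction_degree U (s * t)) / real (s * t) <
      real r * (real ?k - real (rk M U)) / real s"
      using less by (rule order_tendstoD(2))
    then have "\<forall>\<^sub>F t in sequentially. \<not> symbolic_power (mpoly_ring K ?E) ?I (s * t) \<subseteq>
      ideal_power (mpoly_ring K ?E) ?I (r * t)"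
      using eventually_gt_at_top[of 0]
    proof eventually_elim
      case (elim t)
      then have "real (contraction_degree U (s * t)) < real t * (real r * (real ?k - real (rk M U)))"
        using sr(2) by (simp add: field_simps)
      also have "\<dots> = real (r * t * (?k - rk M U))"
        using U(1) unfolding \<A>_def by (simp add: of_nat_diff mult_ac)
      finally have "\<not> r * t * (?k - rk M U) \<le> contraction_degree U (s * t)"
        by (simp only: of_nat_less_iff not_le)
      then show ?case using U(1) subset_iff by blast
    qed
    then have "ereal (real s / real r) \<in> X" unfolding X_def using sr(2,3) by blast
    moreover have "ereal y < ereal (real s / real r)" using q(1) sr(1) by simp
    ultimately show ?thesis by blast
  qed
  have "Sup X = ereal \<rho>"
  proof (rule antisym)
    show "Sup X \<le> ereal \<rho>" using upper by (rule Sup_least)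
    show "ereal \<rho> \<le> Sup X"
    proof (rule ccontr)
      assume "\<not> ereal \<rho> \<le> Sup X"
      then have "Sup X < ereal \<rho>" by simp
      from ereal_dense2[OF this] obtain y where y: "Sup X < ereal y" "ereal y < ereal \<rho>" by auto
      then obtain x where "x \<in> X" "ereal y < x" using lower[of y] by auto
      then have "ereal y < Sup X" using Sup_upper[of x X] by (meson order.strict_trans2)
      then show False using y(1) by simp
    qed
  qed
  then show ?thesis
    unfolding asymptotic_resurgence_def X_def \<rho>_def \<A>_def ratio_def by simp
qed

end

section \<open>Equality of the three maxima\<close>

theorem theorem3p9:
  fixes K :: "'k::field itself"
    and M :: "'e matroid_data"
    and E :: "'e set"
    and k n :: nat
    and S :: "('e, 'k) mpoly ring"
  assumes "matroid M"
    and "E = ground M"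
    and "card E = n"
    and "rk M E = k"
    and "1 \<le> k" and "k < n"
    and "S = mpoly_ring K E"
  shows
    "asymptotic_resurgence S (facet_ideal S M) =
      ereal (MAX U \<in> {U. U \<subseteq> E \<and> rk M U < k}.
        (real k - real (rk M U)) / waldschmidt_constant S (facet_ideal S (contraction M U))) \<and>
     (MAX U \<in> {U. U \<subseteq> E \<and> rk M U < k}.
        (real k - real (rk M U)) / waldschmidt_constant S (facet_ideal S (contraction M U))) =
      (MAX U \<in> {U. U \<in> indep_sets M \<and> card U < k}.
        (real k - real (card U)) / waldschmidt_constant S (facet_ideal S (contraction M U))) \<and>
     (MAX U \<in> {U. U \<in> indep_sets M \<and> card U < k}.
        (real k - real (card U)) / waldschmidt_constant S (facet_ideal S (contraction M U))) =
      (MAX F \<in> flats M - {E}.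
        (real k - real (rk M F)) / waldschmidt_constant S (facet_ideal S (contraction M F)))"
proof -
  interpret matroid M by fact
  note E = assms(2) and S = assms(7)
  have k: "k = rk M (ground M)" using assms by simp
  define ratio where
    "ratio U = (real k - real (rk M U)) / waldschmidt_constant S (facet_ideal S (contraction M U))"
    for U
  let ?A = "{U. U \<subseteq> E \<and> rk M U < k}" and ?B = "{U. U \<in> indep_sets M \<and> card U < k}"
    and ?C = "flats M - {E}"
  \<comment> \<open>Nested sets of equal rank have the same ratio, so any \<open>U\<close> may be
    replaced by a maximal independent subset or by a flat of the same rank above it. The three
    families thus have the same set of ratios, not merely the same maximum.\<close>
  have ratio_cong: "ratio W = ratio V" if "W \<subseteq> V" "V \<subseteq> E" "rk M W = rk M V" for W V
    unfolding ratio_def S E using contraction_waldschmidt_cong[where K = K and W = W and V = V] that E by simp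
  have "U \<subseteq> E" if "U \<in> indep_sets M" for U
    using that bases_subset E unfolding indep_sets_def by auto
  then have indep_sub: "?B \<subseteq> ?A" using rk_indep by auto
  have flats_sub: "?C \<subseteq> ?A"
  proof
    fix F assume "F \<in> ?C"
    then have F: "F \<subseteq> E" "F \<noteq> E" "rk M E = rk M F \<longrightarrow> E = F" unfolding flats_def E by auto
    then have "rk M F \<noteq> k" using k E by auto
    then show "F \<in> ?A" using F rk_le[of F] k by simp
  qed
  have "ratio ` ?A \<subseteq> ratio ` ?B"
  proof
    fix x assume "x \<in> ratio ` ?A"
    then obtain U where U: "x = ratio U" "U \<subseteq> E" "rk M U < k" by blast
    obtain I where I: "I \<in> indep_sets M" "I \<subseteq> U" "card I = rk M U" by (rule indep_attaining_rk)
    then have "x = ratio I" using ratio_cong[of I U] rk_indep U by simp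
    moreover have "I \<in> ?B" using I U by simp
    ultimately show "x \<in> ratio ` ?B" by (rule image_eqI)
  qed
  then have indep: "ratio ` ?A = ratio ` ?B" using indep_sub by blast
  have "ratio ` ?A \<subseteq> ratio ` ?C"
  proof
    fix x assume "x \<in> ratio ` ?A"
    then obtain U where U: "x = ratio U" "U \<subseteq> E" "rk M U < k" by blast
    obtain F where F: "F \<in> flats M" "U \<subseteq> F" "rk M F = rk M U"
      using flat_attaining_rk U(2) E by blast
    then have "x = ratio F" using ratio_cong[of U F] U unfolding flats_def E by simp
    moreover have "F \<in> ?C" using F(1,3) U(3) assms(4) by auto
    ultimately show "x \<in> ratio ` ?C" by (rule image_eqI)
  qed
  then have flats: "ratio ` ?A = ratio ` ?C" using flats_sub by blast
  have "(\<lambda>U. (real k - real (card U)) / waldschmidt_constant S (facet_ideal S (contraction M U))) ` ?B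
    = ratio ` ?B"
    by (rule image_cong) (auto simp: ratio_def rk_indep)
  moreover have "asymptotic_resurgence S (facet_ideal S M) = ereal (Max (ratio ` ?A))"
    using asymptotic_resurgence_eq_Max[of K] assms(5) unfolding ratio_def S E k by simp
  ultimately show ?thesis using indep flats unfolding ratio_def by simp
qed

end
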